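(* Let $p=1$, $q\in[1,\infty]$ and $u_0\in L^q(\mathbb{R}^N)$. The unique maximal $L^q$-solution of $\partial_t^\alpha u+(-\Delta)^\beta u=|u|^{p-1}u=u$ with initial datum $u_0$ is global in time; that is, its maximal existence time is $T_m(u_0)=\infty$.
   Context: Throughout, $N\ge1$ is an integer, $\alpha\in(0,1)$, $\beta\in(0,1]$, and $N>4\beta$. $\partial_t^\alpha$ is the Caputo derivative, $\partial_t^\alpha u(x,t)=\frac1{\Gamma(1-\alpha)}\partial_t\int_0^t\frac{u(x,s)-u(x,0)}{(t-s)^\alpha}ds$, and $(-\Delta)^\beta$ is the operator with Fourier symbol $|\xi|^{2\beta}$. $Z$ is the fundamental solution of $\partial_t^\alpha u+(-\Delta)^\beta u=0$ (initial datum a Dirac mass at $0$), and $Y(x,t)={}^{R}\partial_t^{1-\alpha}Z(x,t)=\frac{1}{\Gamma(\alpha)}\partial_t\int_0^t\frac{Z(x,s)}{(t-s)^{1-\alpha}}ds$. Equivalently, in terms of spatial Fourier transforms, $\hat Z(\xi,t)=E_{\alpha,1}(-|\xi|^{2\beta}t^\alpha)$ and $\hat Y(\xi,t)=t^{\alpha-1}E_{\alpha,\alpha}(-|\xi|^{2\beta}t^\alpha)$, with $E_{\alpha,\gamma}$ the Mittag-Leffler functions. For $p\ge1$, $q\in[1,\infty]$ and $u_0\in L^q(\mathbb{R}^N)$, an $L^q$-solution of $\partial_t^\alpha u+(-\Delta)^\beta u=|u|^{p-1}u$ with initial datum $u_0$ and existence time $T\in(0,\infty]$ is a function $u\in L^\infty_{\rm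 loc}([0,T);L^q(\mathbb{R}^N))$ such that, for almost all $t\in(0,T)$, $$u(x,t)=\int_{\mathbb{R}^N} u_0(y)Z(x-y,t)\,dy+\int_0^t\int_{\mathbb{R}^N}|u(y,s)|^{p-1}u(y,s)Y(x-y,t-s)\,dy\,ds$$ as an identity in $L^q(\mathbb{R}^N)$, and $\operatorname{ess\,lim}_{t\to0^+}\|u(\cdot,t)-u_0\|_{L^q(\mathbb{R}^N)}=0$. When $q>\frac{N}{2\beta}(p-1)$ and $q\ge p$ (every $q\in[1,\infty]$ if $p=1$), $L^q$-solutions are continuous in time with values in $L^q(\mathbb{R}^N)$ and any two with the same datum agree on their common existence interval. The maximal existence time $T_m(u_0)$ is the supremum of the $T>0$ for which an $L^q$-solution with initial datum $u_0$ and existence time $T$ exists; the maximal $L^q$-solution is the $L^q$-solution on $[0,T_m(u_0))$ obtained by setting its value at $t$ equal to that of any $L^q$-solution with initial datum $u_0$ and existence time larger than $t$.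
   Formalization: For q=∞ it is additionally assumed that some L^∞-solution with initial datum u_0 exists on some time interval; for bounded data such as u_0=sign(x_1) no L^∞-solution exists, so the maximal solution would be undefined. *)

theory Defs
  imports "HOL-Probability.Probability"
begin

text \<open>Euclidean space \<open>R^N\<close> is \<^typ>\<open>real ^ 'n\<close> with \<open>N = CARD('n)\<close>.  Functions of \<open>(x, t)\<close> are
  written with time as first argument, so that \<open>u t\<close> is the function \<open>u(\<cdot>, t)\<close> on \<open>R^N\<close>.
  Elements of \<open>L^q\<close> are given by Borel representatives.\<close>

section \<open>Fractional derivatives and the Mittag-Leffler functions\<close>

definition mittag_leffler :: "real \<Rightarrow> real \<Rightarrow> real \<Rightarrow> real" where
  "mittag_leffler \<alpha> \<gamma> z = (\<Sum>k. z ^ k / Gamma (\<alpha> * real k + \<gamma>))"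

text \<open>The Riemann-Liouville derivative of order \<open>\<gamma> \<in> (0,1)\<close> of \<open>f\<close> exists at \<open>t\<close> and equals \<open>D\<close>;
  integrability is demanded so that the integral being differentiated is meaningful.\<close>

definition has_RL_derivative ::
  "real \<Rightarrow> (real \<Rightarrow> 'a::{banach, second_countable_topology}) \<Rightarrow> 'a \<Rightarrow> real \<Rightarrow> bool" where
  "has_RL_derivative \<gamma> f D t \<longleftrightarrow>
     (\<forall>\<^sub>F \<tau> in nhds t. set_integrable lborel {0<..<\<tau>} (\<lambda>s. (\<tau> - s) powr (- \<gamma>) *\<^sub>R f s)) \<and>
     ((\<lambda>\<tau>. (1 / Gamma (1 - \<gamma>)) *\<^sub>R (LINT s:{0<..<\<tau>}|lborel. (\<tau> - s) powr (- \<gamma>) *\<^sub>R f s))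
        has_vector_derivative D) (at t)"

definition has_caputo_derivative ::
  "real \<Rightarrow> (real \<Rightarrow> 'a::{banach, second_countable_topology}) \<Rightarrow> 'a \<Rightarrow> real \<Rightarrow> bool" where
  "has_caputo_derivative \<alpha> f D t \<longleftrightarrow> has_RL_derivative \<alpha> (\<lambda>s. f s - f 0) D t"

section \<open>The kernels \<open>Z\<close> and \<open>Y\<close>\<close>

definition fourier :: "(real ^ 'n \<Rightarrow> real) \<Rightarrow> real ^ 'n \<Rightarrow> complex" where
  "fourier f \<xi> = (LINT x|lborel. cis (- (\<xi> \<bullet> x)) * complex_of_real (f x))"

text \<open>A jointly measurable kernel on \<open>R^N \<times> (0,\<infinity>)\<close>, continuous away from \<open>x = 0\<close>, that belongs to
  \<open>L^1(R^N)\<close> at every time.  Continuity selects a representative; \<open>Z\<close> and \<open>Y\<close> are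
  singular at \<open>x = 0\<close> in the dimensions considered.\<close>

definition regular_kernel :: "(real \<Rightarrow> real ^ 'n \<Rightarrow> real) \<Rightarrow> bool" where
  "regular_kernel K \<longleftrightarrow>
     set_borel_measurable lborel ({0<..} \<times> UNIV) (\<lambda>(t, x). K t x) \<and>
     continuous_on ({0<..} \<times> (- {0})) (\<lambda>(t, x). K t x) \<and>
     (\<forall>t>0. integrable lborel (K t))"

text \<open>The fundamental solution of \<open>\<partial>\<^sub>t\<^sup>\<alpha> u + (-\<Delta>)\<^sup>\<beta> u = 0\<close>.  Since \<open>(-\<Delta>)\<^sup>\<beta>\<close> is the operator with
  symbol \<open>|\<xi>|^(2\<beta>)\<close>, the equation and the initial datum (a Dirac mass, whose Fourier transform
  is \<open>1\<close>) are expressed for the spatial Fourier transform; the last conjunct is the resulting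
  explicit formula.\<close>

definition fundamental_solution :: "real \<Rightarrow> real \<Rightarrow> (real \<Rightarrow> real ^ 'n \<Rightarrow> real) \<Rightarrow> bool" where
  "fundamental_solution \<alpha> \<beta> Z \<longleftrightarrow>
     regular_kernel Z \<and>
     (\<forall>\<xi>. \<forall>t>0. has_caputo_derivative \<alpha> (\<lambda>s. if s = 0 then 1 else fourier (Z s) \<xi>)
        (- complex_of_real (norm \<xi> powr (2 * \<beta>)) * fourier (Z t) \<xi>) t) \<and>
     (\<forall>\<xi>. \<forall>t>0. fourier (Z t) \<xi> =
        complex_of_real (mittag_leffler \<alpha> 1 (- (norm \<xi> powr (2 * \<beta>)) * t powr \<alpha>)))"

text \<open>\<open>Y\<close> is the Riemann-Liouville derivative of order \<open>1 - \<alpha>\<close> in time of \<open>Z\<close>; the last conjunct is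
  the equivalent description by spatial Fourier transforms.\<close>

definition duhamel_kernel ::
  "real \<Rightarrow> real \<Rightarrow> (real \<Rightarrow> real ^ 'n \<Rightarrow> real) \<Rightarrow> (real \<Rightarrow> real ^ 'n \<Rightarrow> real) \<Rightarrow> bool" where
  "duhamel_kernel \<alpha> \<beta> Z Y \<longleftrightarrow>
     regular_kernel Y \<and>
     (\<forall>t>0. \<forall>x. x \<noteq> 0 \<longrightarrow> has_RL_derivative (1 - \<alpha>) (\<lambda>s. Z s x) (Y t x) t) \<and>
     (\<forall>\<xi>. \<forall>t>0. fourier (Y t) \<xi> =
        complex_of_real (t powr (\<alpha> - 1) *
          mittag_leffler \<alpha> \<alpha> (- (norm \<xi> powr (2 * \<beta>)) * t powr \<alpha>)))"

section \<open>Lebesgue norms\<close>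

definition Lq_norm :: "ennreal \<Rightarrow> (real ^ 'n \<Rightarrow> real) \<Rightarrow> ennreal" where
  "Lq_norm q f =
     (if q = \<infinity> then esssup lborel (\<lambda>x. ennreal \<bar>f x\<bar>)
      else let I = (\<integral>\<^sup>+ x. ennreal (\<bar>f x\<bar> powr enn2real q) \<partial>lborel)
           in if I = \<infinity> then \<infinity> else ennreal (enn2real I powr (1 / enn2real q)))"

definition Lq_space :: "ennreal \<Rightarrow> (real ^ 'n \<Rightarrow> real) set" where
  "Lq_space q = {f. f \<in> borel_measurable lborel \<and> Lq_norm q f < \<infinity>}"

section \<open>\<open>L^q\<close>-solutions of \<open>\<partial>\<^sub>t\<^sup>\<alpha> u + (-\<Delta>)\<^sup>\<beta> u = |u|^(p-1) u\<close>\<close>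

text \<open>\<open>u\<close> is a jointly measurable representative of an element of \<open>L^\<infinity>_loc([0,T); L^q(R^N))\<close>.\<close>

definition Linf_loc_Lq :: "ennreal \<Rightarrow> ereal \<Rightarrow> (real \<Rightarrow> real ^ 'n \<Rightarrow> real) \<Rightarrow> bool" where
  "Linf_loc_Lq q T u \<longleftrightarrow>
     set_borel_measurable lborel ({t. 0 < t \<and> ereal t < T} \<times> UNIV) (\<lambda>(t, x). u t x) \<and>
     (\<forall>T'. 0 < T' \<and> ereal T' < T \<longrightarrow>
        (\<exists>C. AE t in lborel. 0 < t \<and> t < T' \<longrightarrow> Lq_norm q (u t) \<le> ennreal C))"

text \<open>Equality in \<open>L^q(R^N)\<close> is equality at almost every \<open>x\<close>.  The integrability conditions make
  the two integrals in the equation meaningful there.  The integral equation is required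
  at almost every time, and the initial datum is attained as an essential limit.\<close>

definition Lq_solution ::
  "(real \<Rightarrow> real ^ 'n \<Rightarrow> real) \<Rightarrow> (real \<Rightarrow> real ^ 'n \<Rightarrow> real) \<Rightarrow> real \<Rightarrow> ennreal \<Rightarrow>
   (real ^ 'n \<Rightarrow> real) \<Rightarrow> ereal \<Rightarrow> (real \<Rightarrow> real ^ 'n \<Rightarrow> real) \<Rightarrow> bool" where
  "Lq_solution Z Y p q u0 T u \<longleftrightarrow>
     0 < T \<and>
     Linf_loc_Lq q T u \<and>
     (AE t in lborel. 0 < t \<and> ereal t < T \<longrightarrow>
        (AE x in lborel.
           integrable lborel (\<lambda>y. u0 y * Z t (x - y)) \<and>
           set_integrable lborel ({0<..<t} \<times> UNIV)
             (\<lambda>(s, y). \<bar>u s y\<bar> powr (p - 1) * u s y * Y (t - s) (x - y)) \<and>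
           u t x = (LINT y|lborel. u0 y * Z t (x - y)) +
             (LINT s:{0<..<t}|lborel. LINT y|lborel.
                \<bar>u s y\<bar> powr (p - 1) * u s y * Y (t - s) (x - y)))) \<and>
     (\<forall>\<epsilon>>0. \<exists>\<delta>>0. AE t in lborel. 0 < t \<and> t < \<delta> \<longrightarrow>
        Lq_norm q (\<lambda>x. u t x - u0 x) < ennreal \<epsilon>)"

definition maximal_existence_time ::
  "(real \<Rightarrow> real ^ 'n \<Rightarrow> real) \<Rightarrow> (real \<Rightarrow> real ^ 'n \<Rightarrow> real) \<Rightarrow> real \<Rightarrow> ennreal \<Rightarrow>
   (real ^ 'n \<Rightarrow> real) \<Rightarrow> ereal" where
  "maximal_existence_time Z Y p q u0 = Sup {T. \<exists>u. Lq_solution Z Y p q u0 T u}"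

text \<open>The maximal solution is the solution on \<open>[0,T\<^sub>m)\<close> that agrees with every solution on the
  existence interval of the latter; as elements of \<open>L^\<infinity>_loc([0,T); L^q)\<close>, solutions are
  compared at almost all times.\<close>

definition maximal_Lq_solution ::
  "(real \<Rightarrow> real ^ 'n \<Rightarrow> real) \<Rightarrow> (real \<Rightarrow> real ^ 'n \<Rightarrow> real) \<Rightarrow> real \<Rightarrow> ennreal \<Rightarrow>
   (real ^ 'n \<Rightarrow> real) \<Rightarrow> (real \<Rightarrow> real ^ 'n \<Rightarrow> real) \<Rightarrow> bool" where
  "maximal_Lq_solution Z Y p q u0 u \<longleftrightarrow>
     Lq_solution Z Y p q u0 (maximal_existence_time Z Y p q u0) u \<and>
     (\<forall>T v. Lq_solution Z Y p q u0 T v \<longrightarrow>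
        (AE t in lborel. 0 < t \<and> ereal t < T \<longrightarrow> (AE x in lborel. u t x = v t x)))"

end

theory Submission
  imports Defs
begin

text \<open>
  For \<open>p = 1\<close> the equation is linear: \<open>u(t) = Z(t) * u0 + \<integral>\<^sub>0\<^sup>t Y(t - s) * u(s) ds\<close>, a Volterra equation in time.
  Its kernel satisfies \<open>\<parallel>Y(t)\<parallel>_1 = c t^(\<alpha> - 1)\<close>, which is integrable at 0 because \<open>\<alpha> > 0\<close>. Hence for a large
  \<open>\<rho>\<close> the mass of \<open>exp (- \<rho> t) Y\<close> over all positive times is at most 1/2 (\<open>contractive_kernel_exists\<close>), and the
  Duhamel operator is a contraction for the norm \<open>sup exp (- \<rho> t) \<parallel>u(t)\<parallel>_q\<close> on the whole half-line
  (\<open>duhamel_nn_halves\<close>). So the Neumann series converges at all times (\<open>duhamel_solution_exists\<close>), and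
  iterating the contraction on the difference of two solutions shows that they agree on their common
  existence interval (\<open>duhamel_subsolution_eq_0\<close>, \<open>Lq_solution_unique\<close>). A global solution that agrees with
  every other solution is the maximal one, and its existence time is infinite.

  The norms of the kernels are read off from the Fourier transforms. These depend on \<open>\<xi>\<close> and \<open>t\<close> through
  \<open>|\<xi>|^(2 \<beta>) t^\<alpha>\<close> and a power of \<open>t\<close>, so by uniqueness of Fourier transforms in \<open>L^1\<close> (\<open>fourier_inj\<close>) the kernel at
  time \<open>t\<close> is, up to that power, the \<open>L^1\<close> normalised dilation by \<open>t^(\<alpha> / (2 \<beta>))\<close> of the kernel at time 1
  (\<open>self_similar_kernel\<close>). In particular \<open>\<parallel>Z(t)\<parallel>_1\<close> does not depend on \<open>t\<close>, and \<open>Z\<close> is an approximate identity,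
  since its integral is the value of its transform at 0, which is 1.

  It remains to see that the datum is attained, that is, \<open>Z(t) * u0 \<rightarrow> u0\<close> in \<open>L^q\<close>; the Duhamel term
  tends to 0 in any case (\<open>duhamel_nn_small_time\<close>). For finite \<open>q\<close> this is the convergence of approximate
  identities (\<open>approximate_identity\<close>), which rests on continuity of translation in \<open>L^q\<close>. For \<open>q = \<infinity>\<close>
  it can fail for a bounded datum, and it is deduced from the solution that is then assumed to exist
  (\<open>initial_datum_attained_of_solution\<close>).
\<close>

section \<open>Norm inequalities from convexity\<close>

text \<open>All size estimates are made for functions with values in \<^typ>\<open>ennreal\<close>, for which integrals and sums
  always make sense; this is the power function on that type.\<close>
definition epow :: "real \<Rightarrow> ennreal \<Rightarrow> ennreal" where
  "epow r x = (if x = \<infinity> then \<infinity> else ennreal (enn2real x powr r))"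

lemma measurable_epow [measurable]: "epow r \<in> borel_measurable borel"
  unfolding epow_def by measurable

lemma epow_ennreal: "0 \<le> a \<Longrightarrow> epow r (ennreal a) = ennreal (a powr r)"
  by (simp add: epow_def)

lemma epow_top [simp]: "epow r \<top> = \<top>"
  by (simp add: epow_def)

lemma epow_0 [simp]: "epow r 0 = 0"
  by (simp add: epow_def)

lemma epow_eq_0_iff: "epow r x = 0 \<longleftrightarrow> x = 0"
  by (cases x) (auto simp: epow_ennreal ennreal_eq_0_iff)

lemma epow_mono: "0 \<le> r \<Longrightarrow> x \<le> y \<Longrightarrow> epow r x \<le> epow r y"
  by (cases x; cases y) (auto simp: epow_ennreal top_unique intro!: ennreal_leI powr_mono2)

lemma epow_mult_ennreal:
  "0 \<le> a \<Longrightarrow> 0 < r \<Longrightarrow> epow r (ennreal a * x) = ennreal (a powr r) * epow r x"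
proof (cases x)
  case (real y)
  assume "0 \<le> a" "0 < r"
  then show ?thesis using real
    by (simp add: epow_ennreal ennreal_mult[symmetric] powr_mult)
next
  case top
  assume "0 \<le> a" "0 < r"
  then show ?thesis using top
    by (cases "a = 0") (auto simp: ennreal_mult_eq_top_iff ennreal_mult_top ennreal_eq_0_iff)
qed

text \<open>The graph of the convex function \<open>x^r\<close> lies above its tangent at \<open>b\<close>; with exponents \<open>r\<close> and
  \<open>r / (r - 1)\<close> this is the inequality of Young for the product of \<open>x\<close> and \<open>b^(r - 1)\<close>.\<close>
lemma powr_tangent:
  fixes x b r :: real
  assumes "0 \<le> x" "0 < b" "1 \<le> r"
  shows "r * b powr (r - 1) * x \<le> x powr r + (r - 1) * b powr r"
proof (cases "r = 1")
  case True
  then show ?thesis using assms by simp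
next
  case False
  define s where "s = r / (r - 1)"
  have r: "r > 1" using False assms by simp
  have s: "s > 1" "1 / r + 1 / s = 1" using r by (auto simp: s_def field_simps)
  have "x * b powr (r - 1) \<le> x powr r / r + (b powr (r - 1)) powr s / s"
    by (rule Youngs_inequality) (use r s assms in auto)
  also have "(b powr (r - 1)) powr s = b powr r"
    using r by (simp add: powr_powr s_def)
  finally show ?thesis using r by (simp add: s_def field_simps)
qed

text \<open>The inequality of Jensen for a measure of mass at most \<open>c\<close>, not necessarily equal to 1. It is the
  source of every norm inequality below. Integrating the tangent inequality at the mean value
  gives it, once the mean value is known to be finite.\<close>
lemma epow_nn_integral_le:
  fixes k w :: "'s \<Rightarrow> ennreal"
  assumes [measurable]: "k \<in> borel_measurable S" "w \<in> borel_measurable S"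
    and mass: "(\<integral>\<^sup>+ s. k s \<partial>S) \<le> ennreal c" and c: "0 < c" and r: "1 \<le> r"
  shows "epow r (\<integral>\<^sup>+ s. k s * w s \<partial>S) \<le> ennreal (c powr (r - 1)) * (\<integral>\<^sup>+ s. k s * epow r (w s) \<partial>S)"
proof (cases "(\<integral>\<^sup>+ s. k s * epow r (w s) \<partial>S) = \<infinity>")
  case True
  then show ?thesis using c by (simp add: ennreal_mult_top)
next
  case False
  then obtain B where B: "0 \<le> B" "(\<integral>\<^sup>+ s. k s * epow r (w s) \<partial>S) = ennreal B"
    by (cases "(\<integral>\<^sup>+ s. k s * epow r (w s) \<partial>S)") auto
  obtain m where m: "0 \<le> m" "m \<le> c" "(\<integral>\<^sup>+ s. k s \<partial>S) = ennreal m"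
    using mass c by (cases "\<integral>\<^sup>+ s. k s \<partial>S") (auto simp: top_unique)
  have tangent: "ennreal (r * b powr (r - 1)) * (\<integral>\<^sup>+ s. k s * w s \<partial>S)
      \<le> ennreal B + ennreal ((r - 1) * b powr r) * ennreal m" if b: "0 < b" for b
  proof -
    have pt: "ennreal (r * b powr (r - 1)) * x \<le> epow r x + ennreal ((r - 1) * b powr r)" for x
      using powr_tangent[OF _ b r, of "enn2real x"] r
      by (cases x) (auto simp: epow_ennreal ennreal_mult[symmetric] ennreal_plus[symmetric] simp del: ennreal_plus intro!: ennreal_leI)
    have "ennreal (r * b powr (r - 1)) * (\<integral>\<^sup>+ s. k s * w s \<partial>S) = (\<integral>\<^sup>+ s. k s * (ennreal (r * b powr (r - 1)) * w s) \<partial>S)"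
      by (subst nn_integral_cmult[symmetric]) (auto simp: ac_simps)
    also have "\<dots> \<le> (\<integral>\<^sup>+ s. k s * (epow r (w s) + ennreal ((r - 1) * b powr r)) \<partial>S)"
      by (intro nn_integral_mono mult_left_mono pt) auto
    also have "\<dots> = (\<integral>\<^sup>+ s. k s * epow r (w s) \<partial>S) + (\<integral>\<^sup>+ s. k s * ennreal ((r - 1) * b powr r) \<partial>S)"
      by (subst nn_integral_add[symmetric]) (auto simp: distrib_left)
    also have "(\<integral>\<^sup>+ s. k s * ennreal ((r - 1) * b powr r) \<partial>S) = ennreal ((r - 1) * b powr r) * ennreal m"
      by (subst nn_integral_multc) (auto simp: m mult.commute)
    finally show ?thesis by (simp add: B)
  qed
  have "(\<integral>\<^sup>+ s. k s * w s \<partial>S) \<noteq> \<infinity>"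
  \<comment> \<open>The tangent at 1 bounds the first moment by the \<open>r\<close>-th moment and the mass.\<close>
  proof
    assume "(\<integral>\<^sup>+ s. k s * w s \<partial>S) = \<infinity>"
    then show False using tangent[of 1] r B m by (auto simp: ennreal_mult_top ennreal_mult[symmetric] ennreal_plus[symmetric] top_unique simp del: ennreal_plus)
  qed
  then obtain a where a: "0 \<le> a" "(\<integral>\<^sup>+ s. k s * w s \<partial>S) = ennreal a"
    by (cases "\<integral>\<^sup>+ s. k s * w s \<partial>S") auto
  have "a powr r \<le> c powr (r - 1) * B"
  proof (cases "a = 0")
    case True
    then show ?thesis using B by simp
  next
    case False
    \<comment> \<open>At the mean value the tangent inequality loses nothing, so this choice gives the sharp constant.\<close>
    define b where "b = a / c"
    have b: "0 < b" using False a c by (simp add: b_def)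
    have "r * b powr (r - 1) * a \<le> B + (r - 1) * b powr r * m"
      using tangent[OF b] r B m a
      by (auto simp: ennreal_mult[symmetric] ennreal_plus[symmetric] simp del: ennreal_plus)
    also have "(r - 1) * b powr r * m \<le> (r - 1) * b powr r * c"
      using r m by (intro mult_left_mono) auto
    also have "b powr (r - 1) * a = b powr r * c"
      using b c a False by (simp add: b_def powr_diff field_simps)
    then have "r * b powr (r - 1) * a = r * (b powr r * c)" by (simp add: mult.assoc)
    finally have "b powr r * c \<le> B" by (simp add: algebra_simps)
    moreover have "a powr r = c powr (r - 1) * (b powr r * c)"
      using a c False by (simp add: b_def powr_divide powr_diff)
    ultimately show ?thesis by (simp add: mult_left_mono)
  qed
  then show ?thesis using a B by (simp add: epow_ennreal ennreal_mult[symmetric])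
qed

text \<open>The bound \<open>\<parallel>f\<parallel>_q \<le> C\<close>, in a form that needs neither measurability nor a root. As a relation it treats
  the essential supremum and the integral norms alike.\<close>
definition Lq_le :: "'a measure \<Rightarrow> ennreal \<Rightarrow> real \<Rightarrow> ('a \<Rightarrow> ennreal) \<Rightarrow> bool" where
  "Lq_le M q C f \<longleftrightarrow>
     (if q = \<infinity> then AE x in M. f x \<le> ennreal C
      else (\<integral>\<^sup>+ x. epow (enn2real q) (f x) \<partial>M) \<le> ennreal (C powr enn2real q))"

lemma enn2real_ge_1: "1 \<le> q \<Longrightarrow> q \<noteq> \<infinity> \<Longrightarrow> 1 \<le> enn2real q"
  by (cases q) (auto simp del: ennreal_1 simp flip: ennreal_1)

lemma Lq_le_mono:
  assumes "Lq_le M q C g" "AE x in M. f x \<le> g x" "0 \<le> C" "C \<le> D"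
  shows "Lq_le M q D f"
proof (cases "q = \<infinity>")
  case True
  have "ennreal C \<le> ennreal D" using assms by (simp add: ennreal_leI)
  then show ?thesis using True assms(1,2) unfolding Lq_le_def by (auto intro: order_trans)
next
  case False
  have "(\<integral>\<^sup>+ x. epow (enn2real q) (f x) \<partial>M) \<le> (\<integral>\<^sup>+ x. epow (enn2real q) (g x) \<partial>M)"
    using assms(2) by (intro nn_integral_mono_AE) (auto intro!: epow_mono)
  also have "\<dots> \<le> ennreal (C powr enn2real q)" using assms False by (simp add: Lq_le_def)
  also have "\<dots> \<le> ennreal (D powr enn2real q)" using assms by (intro ennreal_leI powr_mono2) auto
  finally show ?thesis using False by (simp add: Lq_le_def)
qed

lemma Lq_le_cmult:
  assumes "Lq_le M q C f" "0 \<le> a" "0 \<le> C" "1 \<le> q" and [measurable]: "f \<in> borel_measurable M"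
  shows "Lq_le M q (a * C) (\<lambda>x. ennreal a * f x)"
proof (cases "q = \<infinity>")
  case True
  then show ?thesis using assms by (auto simp: Lq_le_def ennreal_mult intro!: mult_left_mono)
next
  case False
  then have r: "1 \<le> enn2real q" using assms enn2real_ge_1 by auto
  have "(\<integral>\<^sup>+ x. epow (enn2real q) (ennreal a * f x) \<partial>M) =
    ennreal (a powr enn2real q) * (\<integral>\<^sup>+ x. epow (enn2real q) (f x) \<partial>M)"
    using r assms by (subst nn_integral_cmult[symmetric]) (auto simp: epow_mult_ennreal)
  also have "\<dots> \<le> ennreal (a powr enn2real q) * ennreal (C powr enn2real q)"
    using assms False by (intro mult_left_mono) (auto simp: Lq_le_def)
  finally show ?thesis using False assms by (simp add: Lq_le_def powr_mult ennreal_mult[symmetric])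
qed

text \<open>The integral inequality of Minkowski: a superposition, of total weight \<open>c\<close>, of functions of norm at
  most \<open>C\<close> has norm at most \<open>c C\<close>. Convolution with an \<open>L^1\<close> function, the Duhamel integral and sums of
  functions are all superpositions of this kind. For finite \<open>q\<close> the inequality of Jensen is integrated
  over \<open>x\<close> and the order of integration exchanged.\<close>
lemma Lq_le_nn_integral:
  fixes w :: "'s \<Rightarrow> 'a \<Rightarrow> ennreal"
  assumes S: "sigma_finite_measure S" and M: "sigma_finite_measure M" and q: "1 \<le> q"
    and k[measurable]: "k \<in> borel_measurable S"
    and w[measurable]: "(\<lambda>(s, x). w s x) \<in> borel_measurable (S \<Otimes>\<^sub>M M)"
    and mass: "(\<integral>\<^sup>+ s. k s \<partial>S) \<le> ennreal c" and c: "0 < c" and C: "0 \<le> C"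
    and bound: "AE s in S. k s \<noteq> 0 \<longrightarrow> Lq_le M q C (w s)"
  shows "Lq_le M q (c * C) (\<lambda>x. \<integral>\<^sup>+ s. k s * w s x \<partial>S)"
proof -
  interpret S: sigma_finite_measure S by fact
  interpret M: sigma_finite_measure M by fact
  interpret P: pair_sigma_finite S M ..
  show ?thesis
  proof (cases "q = \<infinity>")
    case True
    have "AE s in S. AE x in M. k s * w s x \<le> k s * ennreal C"
      using bound
    proof eventually_elim
      case (elim s)
      show ?case
      proof (cases "k s = 0")
        case False
        then have "AE x in M. w s x \<le> ennreal C" using elim True by (simp add: Lq_le_def)
        then show ?thesis by eventually_elim (rule mult_left_mono, auto)
      qed simp
    qed
    then have "AE x in M. AE s in S. k s * w s x \<le> k s * ennreal C"
      by (subst (asm) P.AE_commute) auto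
    then have "AE x in M. (\<integral>\<^sup>+ s. k s * w s x \<partial>S) \<le> ennreal (c * C)"
    proof eventually_elim
      case (elim x)
      have "(\<integral>\<^sup>+ s. k s * w s x \<partial>S) \<le> (\<integral>\<^sup>+ s. k s * ennreal C \<partial>S)"
        using elim by (rule nn_integral_mono_AE)
      also have "\<dots> = (\<integral>\<^sup>+ s. k s \<partial>S) * ennreal C" by (simp add: nn_integral_multc)
      also have "\<dots> \<le> ennreal c * ennreal C" by (rule mult_right_mono[OF mass]) simp
      finally show ?case using c C by (simp add: ennreal_mult)
    qed
    then show ?thesis using True by (simp add: Lq_le_def)
  next
    case False
    define r where "r = enn2real q"
    have r: "1 \<le> r" using q False enn2real_ge_1 by (auto simp: r_def)
    have "(\<integral>\<^sup>+ x. epow r (\<integral>\<^sup>+ s. k s * w s x \<partial>S) \<partial>M)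
      \<le> (\<integral>\<^sup>+ x. ennreal (c powr (r - 1)) * (\<integral>\<^sup>+ s. k s * epow r (w s x) \<partial>S) \<partial>M)"
      by (intro nn_integral_mono epow_nn_integral_le mass c r) auto
    also have "\<dots> = ennreal (c powr (r - 1)) * (\<integral>\<^sup>+ x. \<integral>\<^sup>+ s. k s * epow r (w s x) \<partial>S \<partial>M)"
      by (rule nn_integral_cmult) measurable
    also have "(\<integral>\<^sup>+ x. \<integral>\<^sup>+ s. k s * epow r (w s x) \<partial>S \<partial>M) = (\<integral>\<^sup>+ s. \<integral>\<^sup>+ x. k s * epow r (w s x) \<partial>M \<partial>S)"
      by (rule P.Fubini') measurable
    also have "\<dots> = (\<integral>\<^sup>+ s. k s * (\<integral>\<^sup>+ x. epow r (w s x) \<partial>M) \<partial>S)"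
      by (intro nn_integral_cong nn_integral_cmult) measurable
    also have "\<dots> \<le> (\<integral>\<^sup>+ s. k s * ennreal (C powr r) \<partial>S)"
      using bound
    proof (intro nn_integral_mono_AE, eventually_elim)
      case (elim s)
      then show ?case using False by (cases "k s = 0") (auto simp: Lq_le_def r_def intro: mult_left_mono)
    qed
    also have "\<dots> = (\<integral>\<^sup>+ s. k s \<partial>S) * ennreal (C powr r)" by (simp add: nn_integral_multc)
    also have "\<dots> \<le> ennreal c * ennreal (C powr r)" by (rule mult_right_mono[OF mass]) simp
    also have "ennreal (c powr (r - 1)) * (ennreal c * ennreal (C powr r)) = ennreal ((c * C) powr r)"
      using c C by (simp add: ennreal_mult[symmetric] powr_mult powr_diff)
    finally show ?thesis using False by (simp add: Lq_le_def r_def mult_left_mono)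
  qed
qed

text \<open>A sum is a superposition over the counting measure if the \<open>i\<close>-th function is normalised by its bound
  \<open>a i\<close> and weighted with it. The index type \<^typ>\<open>bool\<close> gives the triangle inequality and \<^typ>\<open>nat\<close> the
  bound for infinite series.\<close>
lemma Lq_le_sum:
  fixes v :: "'i::countable \<Rightarrow> 'a \<Rightarrow> ennreal"
  assumes M: "sigma_finite_measure M" and q: "1 \<le> q"
    and [measurable]: "\<And>i. v i \<in> borel_measurable M"
    and v: "\<And>i. Lq_le M q (a i) (v i)" and a: "\<And>i. 0 < a i"
    and mass: "(\<integral>\<^sup>+ i. ennreal (a i) \<partial>count_space UNIV) \<le> ennreal c" and c: "0 < c"
  shows "Lq_le M q c (\<lambda>x. \<integral>\<^sup>+ i. v i x \<partial>count_space UNIV)"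
proof -
  have eq: "ennreal (a i) * (ennreal (inverse (a i)) * y) = y" for i y
    using a[of i] by (simp add: mult.assoc[symmetric] ennreal_mult[symmetric])
  have b: "Lq_le M q 1 (\<lambda>x. ennreal (inverse (a i)) * v i x)" for i
    using Lq_le_cmult[OF v[of i], of "inverse (a i)"] a[of i] q by simp
  have "Lq_le M q (c * 1) (\<lambda>x. \<integral>\<^sup>+ i. ennreal (a i) * (ennreal (inverse (a i)) * v i x) \<partial>count_space UNIV)"
    by (rule Lq_le_nn_integral[OF sigma_finite_measure_count_space M q _ _ mass c])
      (auto simp: b intro!: measurable_pair_measure_countable1)
  then show ?thesis by (simp add: eq)
qed

lemma Lq_le_add:
  assumes M: "sigma_finite_measure M" and q: "1 \<le> q"
    and [measurable]: "f \<in> borel_measurable M" "g \<in> borel_measurable M"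
    and fg: "Lq_le M q a f" "Lq_le M q b g" and ab: "0 < a" "0 < b"
  shows "Lq_le M q (a + b) (\<lambda>x. f x + g x)"
proof -
  have "Lq_le M q (a + b) (\<lambda>x. \<integral>\<^sup>+ i. (if i then f else g) x \<partial>count_space (UNIV :: bool set))"
    using ab fg by (intro Lq_le_sum[OF M q, where a = "\<lambda>i. if i then a else b"])
      (auto simp: nn_integral_count_space_finite UNIV_bool ennreal_plus[symmetric] add.commute simp del: ennreal_plus)
  then show ?thesis by (simp add: nn_integral_count_space_finite UNIV_bool add.commute)
qed

lemma Lq_le_imp_finite:
  assumes "Lq_le M q C f" and [measurable]: "f \<in> borel_measurable M"
  shows "AE x in M. f x < \<infinity>"
proof (cases "q = \<infinity>")
  case True
  then have "AE x in M. f x \<le> ennreal C" using assms(1) by (simp add: Lq_le_def)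
  then show ?thesis by eventually_elim (auto intro: le_less_trans)
next
  case False
  have "(\<integral>\<^sup>+ x. epow (enn2real q) (f x) \<partial>M) < \<infinity>"
    using assms False by (auto simp: Lq_le_def intro: le_less_trans)
  then have "AE x in M. epow (enn2real q) (f x) \<noteq> \<infinity>"
    by (intro nn_integral_noteq_infinite) auto
  then show ?thesis by eventually_elim (metis epow_top infinity_ennreal_def less_top)
qed

lemma Lq_le_imp_AE_0:
  assumes small: "\<And>n::nat. Lq_le M q (C n) f" and C: "C \<longlonglongrightarrow> 0" "\<And>n. 0 \<le> C n" and q: "1 \<le> q"
    and [measurable]: "f \<in> borel_measurable M"
  shows "AE x in M. f x = 0"
proof (cases "q = \<infinity>")
  case True
  then have "AE x in M. \<forall>n. f x \<le> ennreal (C n)"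
    using small by (simp add: Lq_le_def AE_all_countable)
  then show ?thesis
  proof eventually_elim
    case (elim x)
    have "(\<lambda>n. ennreal (C n)) \<longlonglongrightarrow> ennreal 0" using C by (intro tendsto_ennrealI)
    then have "f x \<le> ennreal 0" using elim by (intro LIMSEQ_le_const) auto
    then show ?case by simp
  qed
next
  case False
  define r where "r = enn2real q"
  have r: "1 \<le> r" using q False enn2real_ge_1 by (auto simp: r_def)
  have "(\<lambda>n. ennreal (C n powr r)) \<longlonglongrightarrow> ennreal (0 powr r)"
    using C r by (intro tendsto_ennrealI tendsto_powr2) (auto intro!: always_eventually)
  then have "(\<integral>\<^sup>+ x. epow r (f x) \<partial>M) \<le> ennreal (0 powr r)"
    using small False by (intro LIMSEQ_le_const) (auto simp: Lq_le_def r_def)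
  then have "AE x in M. epow r (f x) = 0" by (simp add: nn_integral_0_iff_AE)
  then show ?thesis by (simp add: epow_eq_0_iff)
qed

text \<open>The bridge between the norm that appears in the notion of solution and the relation used in
  the estimates.\<close>
lemma Lq_norm_le_iff:
  fixes f :: "real ^ 'n \<Rightarrow> real"
  assumes [measurable]: "f \<in> borel_measurable lborel" and q: "1 \<le> q" and C: "0 \<le> C"
  shows "Lq_norm q f \<le> ennreal C \<longleftrightarrow> Lq_le lborel q C (\<lambda>x. ennreal \<bar>f x\<bar>)"
proof (cases "q = \<infinity>")
  case True
  have "AE x in lborel. ennreal \<bar>f x\<bar> \<le> esssup lborel (\<lambda>x. ennreal \<bar>f x\<bar>)" by (rule esssup_AE)
  then have "AE x in lborel. ennreal \<bar>f x\<bar> \<le> ennreal C" if "Lq_norm q f \<le> ennreal C"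
    by eventually_elim (use that True in \<open>auto simp: Lq_norm_def intro: order_trans\<close>)
  then show ?thesis using True by (auto simp: Lq_norm_def Lq_le_def intro!: esssup_I)
next
  case False
  define r where "r = enn2real q"
  have r: "1 \<le> r" using q False enn2real_ge_1 by (auto simp: r_def)
  define I where "I = (\<integral>\<^sup>+ x. ennreal (\<bar>f x\<bar> powr r) \<partial>lborel)"
  have "Lq_norm q f = (if I = \<infinity> then \<infinity> else ennreal (enn2real I powr (1 / r)))"
    using False by (simp add: Lq_norm_def I_def r_def)
  moreover have "Lq_le lborel q C (\<lambda>x. ennreal \<bar>f x\<bar>) \<longleftrightarrow> I \<le> ennreal (C powr r)"
    using False by (simp add: Lq_le_def I_def r_def epow_ennreal)
  moreover have "(y powr (1 / r) \<le> C) = (y \<le> C powr r)" if "0 \<le> y" for y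
  proof
    assume "y powr (1 / r) \<le> C"
    then have "(y powr (1 / r)) powr r \<le> C powr r" using r by (intro powr_mono2) auto
    then show "y \<le> C powr r" using r that by (simp add: powr_powr)
  next
    assume "y \<le> C powr r"
    then have "y powr (1 / r) \<le> (C powr r) powr (1 / r)" using r that by (intro powr_mono2) auto
    then show "y powr (1 / r) \<le> C" using r C by (simp add: powr_powr)
  qed
  ultimately show ?thesis using C by (cases I) (auto simp: top_unique)
qed

section \<open>Translations and approximate identities\<close>

lemma nn_integral_lborel_affine:
  fixes f :: "'a::euclidean_space \<Rightarrow> ennreal"
  assumes [measurable]: "f \<in> borel_measurable borel" and c: "c \<noteq> 0"
  shows "(\<integral>\<^sup>+ x. f x \<partial>lborel) = ennreal (\<bar>c\<bar> ^ DIM('a)) * (\<integral>\<^sup>+ x. f (t + c *\<^sub>R x) \<partial>lborel)"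
  by (subst lborel_affine[OF c, of t])
    (simp add: nn_integral_density nn_integral_distr nn_integral_cmult)

lemma nn_integral_lborel_shift:
  fixes f :: "'a::euclidean_space \<Rightarrow> ennreal"
  assumes [measurable]: "f \<in> borel_measurable borel"
  shows "(\<integral>\<^sup>+ x. f (x - h) \<partial>lborel) = (\<integral>\<^sup>+ x. f x \<partial>lborel)"
  using nn_integral_lborel_affine[of f 1 "- h"] by simp

lemma nn_integral_lborel_reflect:
  fixes f :: "'a::euclidean_space \<Rightarrow> ennreal"
  assumes [measurable]: "f \<in> borel_measurable borel"
  shows "(\<integral>\<^sup>+ x. f (h - x) \<partial>lborel) = (\<integral>\<^sup>+ x. f x \<partial>lborel)"
  using nn_integral_lborel_affine[of f "-1" h] by simp

lemma integral_lborel_affine: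
  fixes f :: "'a::euclidean_space \<Rightarrow> 'b::{banach, second_countable_topology}"
  assumes [measurable]: "f \<in> borel_measurable borel" and c: "c \<noteq> 0"
  shows "(\<integral> x. f x \<partial>lborel) = (\<bar>c\<bar> ^ DIM('a)) *\<^sub>R (\<integral> x. f (t + c *\<^sub>R x) \<partial>lborel)"
  by (subst lborel_affine[OF c, of t]) (simp add: integral_density integral_distr)

lemma integrable_lborel_affine:
  fixes f :: "'a::euclidean_space \<Rightarrow> 'b::{banach, second_countable_topology}"
  assumes f: "integrable lborel f" and c: "c \<noteq> 0"
  shows "integrable lborel (\<lambda>x. f (t + c *\<^sub>R x))"
proof -
  have [measurable]: "f \<in> borel_measurable borel" using f by auto
  have "ennreal (\<bar>c\<bar> ^ DIM('a)) * (\<integral>\<^sup>+ x. norm (f (t + c *\<^sub>R x)) \<partial>lborel) < \<infinity>"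
    using nn_integral_lborel_affine[OF _ c, of "\<lambda>x. norm (f x)" t] f by (simp add: integrable_iff_bounded)
  then have "(\<integral>\<^sup>+ x. norm (f (t + c *\<^sub>R x)) \<partial>lborel) < \<infinity>"
    using c by (cases "\<integral>\<^sup>+ x. norm (f (t + c *\<^sub>R x)) \<partial>lborel") (auto simp: ennreal_mult_top)
  then show ?thesis by (auto simp: integrable_iff_bounded)
qed

lemma integrable_lborel_shift:
  fixes f :: "'a::euclidean_space \<Rightarrow> 'b::{banach, second_countable_topology}"
  shows "integrable lborel f \<Longrightarrow> integrable lborel (\<lambda>x. f (x - h))"
  using integrable_lborel_affine[of f 1 "- h"] by simp

lemma integral_lborel_shift:
  fixes f :: "'a::euclidean_space \<Rightarrow> 'b::{banach, second_countable_topology}"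
  assumes "f \<in> borel_measurable borel"
  shows "(\<integral> x. f (x - h) \<partial>lborel) = (\<integral> x. f x \<partial>lborel)"
  using integral_lborel_affine[OF assms, of 1 "- h"] by simp

text \<open>Continuity of translation in \<open>L^1\<close> along one sequence of shifts. Sequences suffice because all limits
  are taken by dominated convergence.\<close>
definition L1_shift_continuous :: "(nat \<Rightarrow> 'a::euclidean_space) \<Rightarrow> ('a \<Rightarrow> real) \<Rightarrow> bool" where
  "L1_shift_continuous h g \<longleftrightarrow> (\<lambda>n. \<integral> x. \<bar>g (x - h n) - g x\<bar> \<partial>lborel) \<longlonglongrightarrow> 0"

text \<open>Shifts preserve the \<open>L^1\<close> norm, so replacing \<open>g\<close> by an approximation changes the distance to the
  shifted function by at most twice the error.\<close>
lemma L1_shift_continuous_approx: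
  fixes g :: "'a::euclidean_space \<Rightarrow> real"
  assumes g: "integrable lborel g"
    and approx: "\<And>e. 0 < e \<Longrightarrow> \<exists>g'. integrable lborel g' \<and> L1_shift_continuous h g' \<and> (\<integral> x. \<bar>g' x - g x\<bar> \<partial>lborel) < e"
  shows "L1_shift_continuous h g"
  unfolding L1_shift_continuous_def
proof (rule LIMSEQ_I)
  fix e :: real assume e: "0 < e"
  obtain g' where g': "integrable lborel g'" "L1_shift_continuous h g'" "(\<integral> x. \<bar>g' x - g x\<bar> \<partial>lborel) < e / 3"
    using approx[of "e / 3"] e by auto
  note [measurable] = borel_measurable_integrable[OF g] borel_measurable_integrable[OF g'(1)]
  obtain n0 where n0: "\<And>n. n \<ge> n0 \<Longrightarrow> (\<integral> x. \<bar>g' (x - h n) - g' x\<bar> \<partial>lborel) < e / 3"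
    using LIMSEQ_D[OF g'(2)[unfolded L1_shift_continuous_def], of "e / 3"] e by auto
  show "\<exists>no. \<forall>n\<ge>no. norm ((\<integral> x. \<bar>g (x - h n) - g x\<bar> \<partial>lborel) - 0) < e"
  proof (intro exI allI impI)
    fix n assume n: "n \<ge> n0"
    have [simp]: "integrable lborel (\<lambda>x. \<bar>g' x - g x\<bar>)" "integrable lborel (\<lambda>x. \<bar>g' (x - h n) - g (x - h n)\<bar>)"
      "integrable lborel (\<lambda>x. \<bar>g' (x - h n) - g' x\<bar>)" "integrable lborel (\<lambda>x. \<bar>g (x - h n) - g x\<bar>)"
      using g g' by (auto intro!: integrable_abs Bochner_Integration.integrable_diff integrable_lborel_shift)
    have "(\<integral> x. \<bar>g (x - h n) - g x\<bar> \<partial>lborel) \<le> (\<integral> x. \<bar>g' (x - h n) - g' x\<bar> + (\<bar>g' (x - h n) - g (x - h n)\<bar> + \<bar>g' x - g x\<bar>) \<partial>lborel)"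
      by (intro integral_mono) auto
    also have "\<dots> = (\<integral> x. \<bar>g' (x - h n) - g' x\<bar> \<partial>lborel) + ((\<integral> x. \<bar>g' (x - h n) - g (x - h n)\<bar> \<partial>lborel) + (\<integral> x. \<bar>g' x - g x\<bar> \<partial>lborel))"
      by simp
    also have "(\<integral> x. \<bar>g' (x - h n) - g (x - h n)\<bar> \<partial>lborel) = (\<integral> x. \<bar>g' x - g x\<bar> \<partial>lborel)"
      by (rule integral_lborel_shift[of "\<lambda>x. \<bar>g' x - g x\<bar>"]) measurable
    finally show "norm ((\<integral> x. \<bar>g (x - h n) - g x\<bar> \<partial>lborel) - 0) < e"
      using n0[OF n] g'(3) by simp
  qed
qed

text \<open>If \<open>x\<close> lies in the open set \<open>U\<close>, then so does \<open>x - h n\<close> for large \<open>n\<close>; hence the part of \<open>U\<close> lost by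
  the shift tends to zero by dominated convergence. Since the shift preserves the measure of \<open>U\<close>, the
  part gained is equally large.\<close>
lemma L1_shift_continuous_indicator_open:
  fixes U :: "'a::euclidean_space set"
  assumes U: "open U" "emeasure lborel U < \<infinity>" and h: "h \<longlonglongrightarrow> 0"
  shows "L1_shift_continuous h (indicator U)"
proof -
  have [measurable]: "U \<in> sets borel" using U by auto
  have int: "integrable lborel (indicator U :: 'a \<Rightarrow> real)" using U by simp
  note int' = integrable_lborel_shift[OF int]
  let ?p = "\<lambda>n x. max 0 (indicator U x - indicator U (x - h n)) :: real"
  have p: "(\<lambda>n. \<integral> x. ?p n x \<partial>lborel) \<longlonglongrightarrow> (\<integral> x. 0 \<partial>(lborel :: 'a measure))"
  proof (rule integral_dominated_convergence[where w = "indicator U"])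
    show "AE x in lborel. (\<lambda>n. ?p n x) \<longlonglongrightarrow> 0"
    proof (intro AE_I2)
      fix x
      show "(\<lambda>n. ?p n x) \<longlonglongrightarrow> 0"
      proof (cases "x \<in> U")
        case True
        have "(\<lambda>n. x - h n) \<longlonglongrightarrow> x - 0" using h by (intro tendsto_intros)
        then have "\<forall>\<^sub>F n in sequentially. x - h n \<in> U"
          using topological_tendstoD U(1) True by auto
        then have "\<forall>\<^sub>F n in sequentially. ?p n x = 0" by eventually_elim simp
        then show ?thesis by (rule tendsto_eventually)
      next
        case False
        then have "?p n x = 0" for n by (auto simp: indicator_def)
        then show ?thesis by simp
      qed
    qed
  qed (use int in \<open>auto simp: indicator_def\<close>)
  have "(\<integral> x. \<bar>indicator U (x - h n) - indicator U x\<bar> \<partial>lborel) = 2 * (\<integral> x. ?p n x \<partial>lborel)" for n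
  proof -
    have [simp]: "integrable lborel (?p n)"
      by (rule Bochner_Integration.integrable_bound[OF int]) (auto simp: indicator_def)
    have "(\<integral> x. \<bar>indicator U (x - h n) - indicator U x\<bar> \<partial>lborel)
        = (\<integral> x. (indicator U (x - h n) - indicator U x) + 2 * ?p n x \<partial>lborel)"
      by (intro Bochner_Integration.integral_cong) (auto simp: indicator_def)
    also have "\<dots> = (\<integral> x. indicator U (x - h n) \<partial>lborel) - (\<integral> x. indicator U x \<partial>lborel) + 2 * (\<integral> x. ?p n x \<partial>lborel)"
      using int int'[of "h n"] by (subst Bochner_Integration.integral_add) (auto simp del: integral_indicator)
    also have "(\<integral> x. indicator U (x - h n) \<partial>lborel) = (\<integral> x. indicator U x \<partial>lborel :: real)"
      by (rule integral_lborel_shift) measurable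
    finally show ?thesis by simp
  qed
  then show ?thesis using tendsto_mult[OF tendsto_const p, of 2] by (simp add: L1_shift_continuous_def)
qed

text \<open>Outer regularity approximates a Borel set by open sets in measure, that is, its indicator in \<open>L^1\<close>.\<close>
lemma L1_shift_continuous_indicator:
  fixes B :: "'a::euclidean_space set"
  assumes B[measurable]: "B \<in> sets lborel" "emeasure lborel B < \<infinity>" and h: "h \<longlonglongrightarrow> 0"
  shows "L1_shift_continuous h (indicator B)"
proof (rule L1_shift_continuous_approx)
  show "integrable lborel (indicator B :: 'a \<Rightarrow> real)" using B by simp
  have [measurable]: "B \<in> sets borel" using B by simp
  fix e :: real assume e: "0 < e"
  obtain U where U: "open U" "B \<subseteq> U" "emeasure lborel (U - B) < e"
    using outer_regular_lborel[of B e] B e by auto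
  have [measurable]: "U \<in> sets borel" using U by auto
  have "emeasure lborel U \<le> emeasure lborel B + emeasure lborel (U - B)"
    using U by (subst plus_emeasure) (auto simp: Un_absorb1)
  also have "\<dots> < \<infinity>" using B U by (auto simp: ennreal_add_eq_top less_top intro: less_trans)
  finally have fin: "emeasure lborel U < \<infinity>" .
  have "(\<integral> x. \<bar>indicator U x - indicator B x :: real\<bar> \<partial>lborel) = (\<integral> x. indicator (U - B) x \<partial>lborel)"
    using U by (intro Bochner_Integration.integral_cong) (auto simp: indicator_def)
  also have "\<dots> = measure lborel (U - B)" by simp
  also have "\<dots> < e" using U(3) e unfolding measure_def by (subst enn2real_less_iff) (auto intro: less_trans)
  finally show "\<exists>g'. integrable lborel g' \<and> L1_shift_continuous h g' \<and> (\<integral> x. \<bar>g' x - indicator B x\<bar> \<partial>lborel) < e"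
    using L1_shift_continuous_indicator_open[OF U(1) fin h] fin by (intro exI[of _ "indicator U"]) auto
qed

text \<open>Every integrable function is an \<open>L^1\<close> limit of linear combinations of indicators.\<close>
lemma L1_shift_continuous:
  fixes g :: "'a::euclidean_space \<Rightarrow> real"
  assumes g: "integrable lborel g" and h: "h \<longlonglongrightarrow> 0"
  shows "L1_shift_continuous h g"
  using g
proof (induction rule: integrable_induct)
  case (base A c)
  have "\<bar>indicator A y * c - indicator A x * c\<bar> = \<bar>c\<bar> * \<bar>indicator A y - indicator A x\<bar>" for x y
    by (simp add: abs_mult flip: left_diff_distrib)
  then show ?case
    using tendsto_mult[OF tendsto_const L1_shift_continuous_indicator[OF base h, unfolded L1_shift_continuous_def], of "\<bar>c\<bar>"]
    by (simp add: L1_shift_continuous_def)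
next
  case (add f g)
  note int = add.hyps integrable_lborel_shift[OF add.hyps(1)] integrable_lborel_shift[OF add.hyps(2)]
  show ?case unfolding L1_shift_continuous_def
  proof (rule tendsto_sandwich[OF _ _ tendsto_const])
    show "(\<lambda>n. (\<integral> x. \<bar>f (x - h n) - f x\<bar> \<partial>lborel) + (\<integral> x. \<bar>g (x - h n) - g x\<bar> \<partial>lborel)) \<longlonglongrightarrow> 0"
      using tendsto_add[OF add.IH[unfolded L1_shift_continuous_def]] by simp
    have "(\<integral> x. \<bar>f (x - h n) + g (x - h n) - (f x + g x)\<bar> \<partial>lborel)
      \<le> (\<integral> x. \<bar>f (x - h n) - f x\<bar> + \<bar>g (x - h n) - g x\<bar> \<partial>lborel)" for n
      using int by (intro integral_mono) auto
    then show "\<forall>\<^sub>F n in sequentially. (\<integral> x. \<bar>f (x - h n) + g (x - h n) - (f x + g x)\<bar> \<partial>lborel)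
      \<le> (\<integral> x. \<bar>f (x - h n) - f x\<bar> \<partial>lborel) + (\<integral> x. \<bar>g (x - h n) - g x\<bar> \<partial>lborel)"
      using int by (intro always_eventually) simp
  qed (intro always_eventually allI, simp)
next
  case (lim f s)
  note [measurable] = borel_measurable_integrable[OF lim.hyps(1)] borel_measurable_integrable[OF lim.hyps(4)]
  show ?case
  proof (rule L1_shift_continuous_approx[OF lim.hyps(4)])
    fix e :: real assume e: "0 < e"
    have "(\<lambda>i. \<integral> x. \<bar>s i x - f x\<bar> \<partial>lborel) \<longlonglongrightarrow> (\<integral> x. 0 \<partial>(lborel :: 'a measure))"
    proof (rule integral_dominated_convergence[where w = "\<lambda>x. 3 * \<bar>f x\<bar>"])
      show "AE x in lborel. (\<lambda>i. \<bar>s i x - f x\<bar>) \<longlonglongrightarrow> 0"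
        using lim.hyps(2) by (intro AE_I2 tendsto_rabs_zero) (simp add: LIM_zero)
      show "AE x in lborel. norm \<bar>s i x - f x\<bar> \<le> 3 * \<bar>f x\<bar>" for i
      proof (intro AE_I2)
        fix x show "norm \<bar>s i x - f x\<bar> \<le> 3 * \<bar>f x\<bar>"
          using lim.hyps(3)[of x i] by (auto simp: abs_if split: if_splits)
      qed
    qed (use lim.hyps(4) in auto)
    then obtain i where "(\<integral> x. \<bar>s i x - f x\<bar> \<partial>lborel) < e"
      using LIMSEQ_D[of _ 0 e] e by fastforce
    then show "\<exists>g'. integrable lborel g' \<and> L1_shift_continuous h g' \<and> (\<integral> x. \<bar>g' x - f x\<bar> \<partial>lborel) < e"
      using lim.hyps(1) lim.IH by blast
  qed
qed

lemma powr_superadditive: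
  fixes x y r :: real
  assumes "0 \<le> x" "0 \<le> y" "1 \<le> r"
  shows "x powr r + y powr r \<le> (x + y) powr r"
proof -
  have *: "a powr r = a * a powr (r - 1)" if "0 \<le> a" for a :: real
    using that powr_add[of a 1 "r - 1"] by (cases "a = 0") auto
  have "x powr r + y powr r = x * x powr (r - 1) + y * y powr (r - 1)"
    using assms by (simp add: *)
  also have "\<dots> \<le> x * (x + y) powr (r - 1) + y * (x + y) powr (r - 1)"
    using assms by (intro add_mono mult_left_mono powr_mono2) auto
  also have "\<dots> = (x + y) powr r" using assms by (simp add: *[of "x + y"] distrib_right)
  finally show ?thesis .
qed

lemma powr_add_le:
  fixes x y r :: real
  assumes "0 \<le> x" "0 \<le> y" "0 \<le> r"
  shows "(x + y) powr r \<le> 2 powr r * (x powr r + y powr r)"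
proof -
  have "(x + y) powr r \<le> (2 * max x y) powr r" using assms by (intro powr_mono2) auto
  also have "\<dots> = 2 powr r * max x y powr r" using assms by (simp add: powr_mult)
  also have "\<dots> \<le> 2 powr r * (x powr r + y powr r)" by (intro mult_left_mono) (auto simp: max_def)
  finally show ?thesis .
qed

text \<open>The map \<open>a \<mapsto> sgn a |a|^r\<close> carries \<open>L^r\<close> into \<open>L^1\<close> and so reduces continuity of translation in \<open>L^r\<close>
  to \<open>L^1\<close>.\<close>
definition signed_powr :: "real \<Rightarrow> real \<Rightarrow> real" where
  "signed_powr r a = sgn a * \<bar>a\<bar> powr r"

lemma measurable_signed_powr [measurable]: "signed_powr r \<in> borel_measurable borel"
  unfolding signed_powr_def by measurable

text \<open>For equal signs \<open>|a - b|^r\<close> is at most \<open>||a|^r - |b|^r|\<close> because powers are superadditive; for opposite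
  signs \<open>|a - b| = |a| + |b|\<close> and the factor \<open>2^r\<close> appears.\<close>
lemma powr_diff_le_signed_powr:
  assumes r: "1 \<le> r"
  shows "\<bar>a - b\<bar> powr r \<le> 2 powr r * \<bar>signed_powr r a - signed_powr r b\<bar>"
proof -
  have one: "1 \<le> 2 powr r" using r by (simp add: ge_one_powr_ge_zero)
  have pos: "\<bar>a - b\<bar> powr r \<le> \<bar>a powr r - b powr r\<bar>" if "0 \<le> a" "0 \<le> b" for a b :: real
  proof (cases "a \<le> b")
    case True
    then show ?thesis using powr_superadditive[of a "b - a" r] r that by (auto simp: abs_if)
  next
    case False
    then show ?thesis using powr_superadditive[of b "a - b" r] r that by (auto simp: abs_if)
  qed
  have opp: "(a + b) powr r \<le> 2 powr r * (a powr r + b powr r)" if "0 \<le> a" "0 \<le> b" for a b :: real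
    using powr_add_le[of a b r] r that by simp
  have pos': "\<bar>a - b\<bar> powr r \<le> 2 powr r * \<bar>a powr r - b powr r\<bar>" if "0 \<le> a" "0 \<le> b" for a b :: real
    using pos[OF that] mult_right_mono[OF one, of "\<bar>a powr r - b powr r\<bar>"] by simp
  consider "0 \<le> a" "0 \<le> b" | "0 \<le> a" "b < 0" | "a < 0" "0 \<le> b" | "a < 0" "b < 0" by linarith
  then show ?thesis
  proof cases
    case 1
    then show ?thesis using pos'[of a b] by (auto simp: signed_powr_def sgn_if)
  next
    case 2
    then show ?thesis using opp[of a "-b"] by (auto simp: signed_powr_def sgn_if)
  next
    case 3
    then have s: "signed_powr r a = - ((- a) powr r)" "signed_powr r b = b powr r"
      by (auto simp: signed_powr_def sgn_if)
    have "\<bar>a - b\<bar> = - a + b" using 3 by simp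
    moreover have "\<bar>signed_powr r a - signed_powr r b\<bar> = (- a) powr r + b powr r"
      using powr_ge_zero[of "- a" r] powr_ge_zero[of b r] unfolding s by linarith
    ultimately show ?thesis using opp[of "-a" b] 3 by simp
  next
    case 4
    then have "\<bar>a - b\<bar> = \<bar>- a - - b\<bar>" "\<bar>signed_powr r a - signed_powr r b\<bar> = \<bar>(- a) powr r - (- b) powr r\<bar>"
      by (auto simp: signed_powr_def sgn_if abs_if)
    then show ?thesis using pos'[of "-a" "-b"] 4 by simp
  qed
qed

lemma Lq_shift_continuous:
  fixes f :: "'a::euclidean_space \<Rightarrow> real"
  assumes [measurable]: "f \<in> borel_measurable borel"
    and fin: "(\<integral>\<^sup>+ x. ennreal (\<bar>f x\<bar> powr r) \<partial>lborel) < \<infinity>" and r: "1 \<le> r" and h: "h \<longlonglongrightarrow> 0"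
  shows "(\<lambda>n. \<integral>\<^sup>+ x. ennreal (\<bar>f (x - h n) - f x\<bar> powr r) \<partial>lborel) \<longlonglongrightarrow> 0"
proof -
  define g where "g x = signed_powr r (f x)" for x
  have [measurable]: "g \<in> borel_measurable borel" unfolding g_def by measurable
  have "ennreal (norm (g x)) = ennreal (\<bar>f x\<bar> powr r)" for x
    by (auto simp: g_def signed_powr_def abs_mult sgn_if)
  then have g: "integrable lborel g"
    using fin by (simp add: integrable_iff_bounded)
  have le: "(\<integral>\<^sup>+ x. ennreal (\<bar>f (x - h n) - f x\<bar> powr r) \<partial>lborel)
      \<le> ennreal (2 powr r * (\<integral> x. \<bar>g (x - h n) - g x\<bar> \<partial>lborel))" for n
  proof -
    have "(\<integral>\<^sup>+ x. ennreal (\<bar>f (x - h n) - f x\<bar> powr r) \<partial>lborel)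
      \<le> (\<integral>\<^sup>+ x. ennreal (2 powr r * \<bar>g (x - h n) - g x\<bar>) \<partial>lborel)"
      unfolding g_def by (intro nn_integral_mono ennreal_leI powr_diff_le_signed_powr r)
    also have "\<dots> = ennreal (\<integral> x. 2 powr r * \<bar>g (x - h n) - g x\<bar> \<partial>lborel)"
      using g integrable_lborel_shift[OF g, of "h n"] by (intro nn_integral_eq_integral) auto
    finally show ?thesis by simp
  qed
  have "(\<lambda>n. ennreal (2 powr r * (\<integral> x. \<bar>g (x - h n) - g x\<bar> \<partial>lborel))) \<longlonglongrightarrow> ennreal (2 powr r * 0)"
    using L1_shift_continuous[OF g h] unfolding L1_shift_continuous_def by (intro tendsto_ennrealI tendsto_mult tendsto_const)
  then have lim: "(\<lambda>n. ennreal (2 powr r * (\<integral> x. \<bar>g (x - h n) - g x\<bar> \<partial>lborel))) \<longlonglongrightarrow> 0" by simp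
  show ?thesis
    by (rule tendsto_sandwich[OF _ _ tendsto_const lim]) (auto intro!: always_eventually le)
qed

text \<open>By the inequality of Jensen the integral is at most a constant times that of \<open>|K z| \<omega>(s n z)\<close> over \<open>z\<close>,
  where \<open>\<omega>(h)\<close> is the \<open>r\<close>-th power of the \<open>L^r\<close> distance between \<open>f\<close> and its shift by \<open>h\<close>. The function \<open>\<omega>\<close>
  is bounded and tends to 0 with \<open>h\<close>, so dominated convergence applies.\<close>
lemma approximate_identity:
  fixes f K :: "'a::euclidean_space \<Rightarrow> real"
  assumes f[measurable]: "f \<in> borel_measurable borel"
    and fin: "(\<integral>\<^sup>+ x. ennreal (\<bar>f x\<bar> powr r) \<partial>lborel) < \<infinity>" and r: "1 \<le> r"
    and K: "integrable lborel K" and s: "s \<longlonglongrightarrow> 0"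
  shows "(\<lambda>n. \<integral>\<^sup>+ x. epow r (\<integral>\<^sup>+ z. ennreal \<bar>K z\<bar> * ennreal \<bar>f (x - s n *\<^sub>R z) - f x\<bar> \<partial>lborel) \<partial>lborel) \<longlonglongrightarrow> 0"
proof -
  have [measurable]: "K \<in> borel_measurable borel" using K by auto
  have p[measurable]: "(\<lambda>x. x powr r) \<in> borel_measurable borel" by measurable
  \<comment> \<open>Adding 1 keeps \<open>c\<close> positive, as the inequality of Jensen requires, even if \<open>K = 0\<close>.\<close>
  define c where "c = (\<integral> z. \<bar>K z\<bar> \<partial>lborel) + 1"
  have c: "0 < c" "(\<integral>\<^sup>+ z. ennreal \<bar>K z\<bar> \<partial>lborel) \<le> ennreal c"
    using K by (auto simp: c_def nn_integral_eq_integral add_nonneg_pos intro!: ennreal_leI)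
  define \<omega> where "\<omega> h = (\<integral>\<^sup>+ x. ennreal (\<bar>f (x - h) - f x\<bar> powr r) \<partial>lborel)" for h
  have [measurable]: "\<omega> \<in> borel_measurable borel" unfolding \<omega>_def by measurable
  define B where "B = (\<integral>\<^sup>+ x. ennreal (\<bar>f x\<bar> powr r) \<partial>lborel)"
  have \<omega>_le: "\<omega> h \<le> ennreal (2 powr r) * (B + B)" for h
  proof -
    have "\<omega> h \<le> (\<integral>\<^sup>+ x. ennreal (2 powr r) * (ennreal (\<bar>f (x - h)\<bar> powr r) + ennreal (\<bar>f x\<bar> powr r)) \<partial>lborel)"
      unfolding \<omega>_def
    proof (intro nn_integral_mono)
      fix x
      have "\<bar>f (x - h) - f x\<bar> powr r \<le> (\<bar>f (x - h)\<bar> + \<bar>f x\<bar>) powr r" using r by (intro powr_mono2) auto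
      also have "\<dots> \<le> 2 powr r * (\<bar>f (x - h)\<bar> powr r + \<bar>f x\<bar> powr r)" using r by (intro powr_add_le) auto
      finally show "ennreal (\<bar>f (x - h) - f x\<bar> powr r) \<le> ennreal (2 powr r) * (ennreal (\<bar>f (x - h)\<bar> powr r) + ennreal (\<bar>f x\<bar> powr r))"
        by (simp add: ennreal_mult[symmetric] ennreal_plus[symmetric] ennreal_leI del: ennreal_plus)
    qed
    also have "\<dots> = ennreal (2 powr r) * ((\<integral>\<^sup>+ x. ennreal (\<bar>f (x - h)\<bar> powr r) \<partial>lborel) + B)"
      by (simp add: nn_integral_cmult nn_integral_add B_def)
    also have "(\<integral>\<^sup>+ x. ennreal (\<bar>f (x - h)\<bar> powr r) \<partial>lborel) = B"
      unfolding B_def by (rule nn_integral_lborel_shift[of "\<lambda>x. ennreal (\<bar>f x\<bar> powr r)"]) measurable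
    finally show ?thesis .
  qed
  have le: "(\<integral>\<^sup>+ x. epow r (\<integral>\<^sup>+ z. ennreal \<bar>K z\<bar> * ennreal \<bar>f (x - s n *\<^sub>R z) - f x\<bar> \<partial>lborel) \<partial>lborel)
      \<le> ennreal (c powr (r - 1)) * (\<integral>\<^sup>+ z. ennreal \<bar>K z\<bar> * \<omega> (s n *\<^sub>R z) \<partial>lborel)" for n
  proof -
    have "(\<integral>\<^sup>+ x. epow r (\<integral>\<^sup>+ z. ennreal \<bar>K z\<bar> * ennreal \<bar>f (x - s n *\<^sub>R z) - f x\<bar> \<partial>lborel) \<partial>lborel)
      \<le> (\<integral>\<^sup>+ x. ennreal (c powr (r - 1)) * (\<integral>\<^sup>+ z. ennreal \<bar>K z\<bar> * epow r (ennreal \<bar>f (x - s n *\<^sub>R z) - f x\<bar>) \<partial>lborel) \<partial>lborel)"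
      by (intro nn_integral_mono epow_nn_integral_le c r) auto
    also have "\<dots> = ennreal (c powr (r - 1)) * (\<integral>\<^sup>+ x. (\<integral>\<^sup>+ z. ennreal \<bar>K z\<bar> * epow r (ennreal \<bar>f (x - s n *\<^sub>R z) - f x\<bar>) \<partial>lborel) \<partial>lborel)"
      by (rule nn_integral_cmult) measurable
    also have "(\<integral>\<^sup>+ x. (\<integral>\<^sup>+ z. ennreal \<bar>K z\<bar> * epow r (ennreal \<bar>f (x - s n *\<^sub>R z) - f x\<bar>) \<partial>lborel) \<partial>lborel)
      = (\<integral>\<^sup>+ z. (\<integral>\<^sup>+ x. ennreal \<bar>K z\<bar> * epow r (ennreal \<bar>f (x - s n *\<^sub>R z) - f x\<bar>) \<partial>lborel) \<partial>lborel)"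
      by (rule lborel_pair.Fubini') measurable
    also have "\<dots> = (\<integral>\<^sup>+ z. ennreal \<bar>K z\<bar> * \<omega> (s n *\<^sub>R z) \<partial>lborel)"
      by (intro nn_integral_cong) (simp add: nn_integral_cmult \<omega>_def epow_ennreal)
    finally show ?thesis .
  qed
  have "(\<lambda>n. \<integral>\<^sup>+ z. ennreal \<bar>K z\<bar> * \<omega> (s n *\<^sub>R z) \<partial>lborel) \<longlonglongrightarrow> (\<integral>\<^sup>+ z. 0 \<partial>(lborel :: 'a measure))"
  proof (rule nn_integral_dominated_convergence[where w = "\<lambda>z. ennreal \<bar>K z\<bar> * (ennreal (2 powr r) * (B + B))"])
    show "AE z in lborel. ennreal \<bar>K z\<bar> * \<omega> (s n *\<^sub>R z) \<le> ennreal \<bar>K z\<bar> * (ennreal (2 powr r) * (B + B))" for n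
      by (intro AE_I2 mult_left_mono \<omega>_le) auto
    have "(\<integral>\<^sup>+ z. ennreal \<bar>K z\<bar> * (ennreal (2 powr r) * (B + B)) \<partial>lborel) \<le> ennreal c * (ennreal (2 powr r) * (B + B))"
      by (subst nn_integral_multc) (auto intro!: mult_right_mono c)
    also have "\<dots> < \<infinity>" using fin by (simp add: B_def ennreal_mult_less_top)
    finally show "(\<integral>\<^sup>+ z. ennreal \<bar>K z\<bar> * (ennreal (2 powr r) * (B + B)) \<partial>lborel) < \<infinity>" .
    show "AE z in lborel. (\<lambda>n. ennreal \<bar>K z\<bar> * \<omega> (s n *\<^sub>R z)) \<longlonglongrightarrow> 0"
    proof (intro AE_I2)
      fix z :: 'a
      have "(\<lambda>n. s n *\<^sub>R z) \<longlonglongrightarrow> 0 *\<^sub>R z" by (rule tendsto_scaleR[OF s tendsto_const])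
      then have "(\<lambda>n. s n *\<^sub>R z) \<longlonglongrightarrow> 0" by simp
      then have "(\<lambda>n. \<omega> (s n *\<^sub>R z)) \<longlonglongrightarrow> 0"
        unfolding \<omega>_def by (intro Lq_shift_continuous fin r f)
      then have "(\<lambda>n. ennreal \<bar>K z\<bar> * \<omega> (s n *\<^sub>R z)) \<longlonglongrightarrow> ennreal \<bar>K z\<bar> * 0"
        by (intro ennreal_tendsto_cmult) auto
      then show "(\<lambda>n. ennreal \<bar>K z\<bar> * \<omega> (s n *\<^sub>R z)) \<longlonglongrightarrow> 0" by simp
    qed
  qed measurable
  then have "(\<lambda>n. ennreal (c powr (r - 1)) * (\<integral>\<^sup>+ z. ennreal \<bar>K z\<bar> * \<omega> (s n *\<^sub>R z) \<partial>lborel)) \<longlonglongrightarrow> ennreal (c powr (r - 1)) * 0"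
    by (intro ennreal_tendsto_cmult) auto
  then have lim: "(\<lambda>n. ennreal (c powr (r - 1)) * (\<integral>\<^sup>+ z. ennreal \<bar>K z\<bar> * \<omega> (s n *\<^sub>R z) \<partial>lborel)) \<longlonglongrightarrow> 0" by simp
  show ?thesis
    by (rule tendsto_sandwich[OF _ _ tendsto_const lim]) (auto intro!: always_eventually le)
qed

text \<open>With \<open>\<integral>K = 1\<close>, \<open>f x\<close> is the integral of \<open>K z * f x\<close>. If the integrand on the left is
  not integrable, the right-hand side is infinite, so the bound holds at every point.\<close>
lemma mollification_error_le:
  fixes f K :: "'a::euclidean_space \<Rightarrow> real"
  assumes [measurable]: "f \<in> borel_measurable borel"
    and K: "integrable lborel K" and K1: "(\<integral> z. K z \<partial>lborel) = 1"
  shows "ennreal \<bar>(\<integral> z. K z * f (x - s *\<^sub>R z) \<partial>lborel) - f x\<bar>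
    \<le> (\<integral>\<^sup>+ z. ennreal \<bar>K z\<bar> * ennreal \<bar>f (x - s *\<^sub>R z) - f x\<bar> \<partial>lborel)"
proof (cases "integrable lborel (\<lambda>z. K z * f (x - s *\<^sub>R z))")
  case True
  have "(\<integral> z. K z * f (x - s *\<^sub>R z) \<partial>lborel) - f x = (\<integral> z. K z * (f (x - s *\<^sub>R z) - f x) \<partial>lborel)"
    using True K K1 by (simp add: right_diff_distrib)
  moreover have "integrable lborel (\<lambda>z. K z * (f (x - s *\<^sub>R z) - f x))"
    using True K by (simp add: right_diff_distrib)
  ultimately show ?thesis
    using integral_norm_bound_ennreal[of lborel "\<lambda>z. K z * (f (x - s *\<^sub>R z) - f x)"]
    by (simp add: abs_mult ennreal_mult)
next
  case False
  have [measurable]: "K \<in> borel_measurable borel" using K by auto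
  have "(\<integral>\<^sup>+ z. ennreal \<bar>K z\<bar> * ennreal \<bar>f (x - s *\<^sub>R z) - f x\<bar> \<partial>lborel) = \<infinity>"
  proof (rule ccontr)
    assume "\<not> ?thesis"
    then have "integrable lborel (\<lambda>z. K z * (f (x - s *\<^sub>R z) - f x))"
      by (auto simp: integrable_iff_bounded abs_mult ennreal_mult less_top)
    then have "integrable lborel (\<lambda>z. K z * (f (x - s *\<^sub>R z) - f x) + K z * f x)"
      using K by (intro Bochner_Integration.integrable_add) auto
    then show False using False by (simp add: algebra_simps)
  qed
  then show ?thesis by simp
qed

section \<open>Uniqueness of Fourier transforms and self-similar kernels\<close>

text \<open>Fubini for a product of functions of the single coordinates.\<close>
lemma lborel_integral_prod:
  fixes f :: "'a::euclidean_space \<Rightarrow> real \<Rightarrow> 'b::{real_normed_field, banach, second_countable_topology}"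
  assumes f: "\<And>b. b \<in> Basis \<Longrightarrow> integrable lborel (f b)"
  shows "integrable lborel (\<lambda>x. \<Prod>b\<in>Basis. f b (x \<bullet> b))"
    and "(\<integral> x. (\<Prod>b\<in>Basis. f b (x \<bullet> b)) \<partial>lborel) = (\<Prod>b\<in>Basis. \<integral> x. f b x \<partial>lborel)"
proof -
  interpret product_sigma_finite "\<lambda>_::'a. lborel :: real measure"
    by standard
  have [measurable]: "f b \<in> borel_measurable borel" if "b \<in> Basis" for b
    using f[OF that] by auto
  have [measurable]: "(\<lambda>x::'a. \<Prod>b\<in>Basis. f b (x \<bullet> b)) \<in> borel_measurable borel"
    by (intro borel_measurable_prod) measurable
  have [measurable]: "(\<lambda>\<phi>. \<Sum>b\<in>Basis. \<phi> b *\<^sub>R b) \<in> (\<Pi>\<^sub>M b\<in>Basis. lborel) \<rightarrow>\<^sub>M (borel :: 'a measure)"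
    by measurable
  show "integrable lborel (\<lambda>x. \<Prod>b\<in>Basis. f b (x \<bullet> b))"
    using product_integrable_prod[of Basis f] f
    by (subst lborel_eq) (simp add: integrable_distr_eq)
  show "(\<integral> x. (\<Prod>b\<in>Basis. f b (x \<bullet> b)) \<partial>lborel) = (\<Prod>b\<in>Basis. \<integral> x. f b x \<partial>lborel)"
    using product_integral_prod[of Basis f] f
    by (subst lborel_eq) (simp add: integral_distr)
qed

text \<open>The standard normal density on Euclidean space. Up to a constant factor it is its own Fourier
  transform, which makes it both an integrable function of integral 1 and a superposition of
  characters.\<close>
definition gauss :: "'a::euclidean_space \<Rightarrow> real" where
  "gauss x = (\<Prod>b\<in>Basis. std_normal_density (x \<bullet> b))"

lemma measurable_gauss [measurable]: "gauss \<in> borel_measurable borel"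
  unfolding gauss_def by measurable

lemma integrable_gauss: "integrable lborel (gauss :: 'a::euclidean_space \<Rightarrow> real)"
  unfolding gauss_def[abs_def] by (rule lborel_integral_prod) simp

lemma integral_gauss: "(\<integral> x. gauss x \<partial>(lborel :: 'a::euclidean_space measure)) = 1"
  unfolding gauss_def by (subst lborel_integral_prod(2)) simp_all

lemma cis_inner_prod: "cis ((\<xi>::'a::euclidean_space) \<bullet> z) = (\<Prod>b\<in>Basis. cis ((\<xi> \<bullet> b) * (z \<bullet> b)))"
proof -
  have "(\<Prod>b\<in>A. cis (g b)) = cis (\<Sum>b\<in>A. g b)" if "finite A" for g :: "'a \<Rightarrow> real" and A
    using that by induction (auto simp: cis_mult)
  then show ?thesis by (subst euclidean_inner) simp
qed

lemma std_normal_transform: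
  shows "integrable lborel (\<lambda>x. complex_of_real (std_normal_density x) * cis (x * t))"
    and "(\<integral> x. complex_of_real (std_normal_density x) * cis (x * t) \<partial>lborel)
      = complex_of_real (sqrt (2 * pi) * std_normal_density t)"
proof -
  show "integrable lborel (\<lambda>x. complex_of_real (std_normal_density x) * cis (x * t))"
    by (rule Bochner_Integration.integrable_bound[of _ std_normal_density])
      (auto simp: norm_mult cis_conv_exp)
  have "complex_of_real (sqrt (2 * pi) * std_normal_density t) = complex_of_real (exp (- (t\<^sup>2) / 2))"
    by (simp add: std_normal_density_def)
  also have "\<dots> = char std_normal_distribution t"
    by (simp only: char_std_normal_distribution)
  also have "\<dots> = (\<integral> x. std_normal_density x *\<^sub>R iexp (t * x) \<partial>lborel)"
    unfolding char_def by (subst integral_density) auto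
  also have "\<dots> = (\<integral> x. complex_of_real (std_normal_density x) * cis (x * t) \<partial>lborel)"
    by (simp add: cis_conv_exp scaleR_conv_of_real mult.commute)
  finally show "(\<integral> x. complex_of_real (std_normal_density x) * cis (x * t) \<partial>lborel)
      = complex_of_real (sqrt (2 * pi) * std_normal_density t)" ..
qed

lemma gauss_transform:
  fixes z :: "'a::euclidean_space"
  shows "(\<integral> \<xi>. complex_of_real (gauss \<xi>) * cis (\<xi> \<bullet> z) \<partial>lborel)
    = complex_of_real (sqrt (2 * pi) ^ DIM('a) * gauss z)"
proof -
  have "(\<integral> \<xi>. complex_of_real (gauss \<xi>) * cis (\<xi> \<bullet> z) \<partial>lborel)
    = (\<integral> \<xi>. (\<Prod>b\<in>Basis. complex_of_real (std_normal_density (\<xi> \<bullet> b)) * cis ((\<xi> \<bullet> b) * (z \<bullet> b))) \<partial>lborel)"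
    by (simp add: gauss_def cis_inner_prod prod.distrib)
  also have "\<dots> = (\<Prod>b\<in>Basis. complex_of_real (sqrt (2 * pi) * std_normal_density (z \<bullet> b)))"
    by (subst lborel_integral_prod(2)) (simp_all only: std_normal_transform)
  also have "\<dots> = complex_of_real (sqrt (2 * pi) ^ DIM('a) * gauss z)"
    by (simp add: gauss_def prod.distrib)
  finally show ?thesis .
qed

text \<open>A Gaussian mean of \<open>f\<close> is a superposition of values of the Fourier transform of \<open>f\<close>: the Gaussian is
  replaced by the integral that represents it as a Fourier transform, and the order of integration
  is exchanged.\<close>
lemma gauss_convolution_eq_0:
  fixes f :: "real ^ 'n \<Rightarrow> real"
  assumes f: "integrable lborel f" and zero: "\<And>\<xi>. fourier f \<xi> = 0" and s: "0 < s"
  shows "(\<integral> z. gauss z * f (x - s *\<^sub>R z) \<partial>lborel) = 0"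
proof -
  have [measurable]: "f \<in> borel_measurable borel" using f by auto
  let ?c = "complex_of_real (sqrt (2 * pi) ^ DIM(real ^ 'n))"
  let ?w = "\<lambda>y. (1 / s) *\<^sub>R (x - y)"
  let ?F = "\<lambda>y \<xi>. complex_of_real (f y) * (complex_of_real (gauss \<xi>) * cis (\<xi> \<bullet> ?w y))"
  have "(\<integral>\<^sup>+ p. norm (case p of (y, \<xi>) \<Rightarrow> ?F y \<xi>) \<partial>(lborel \<Otimes>\<^sub>M lborel))
      = (\<integral>\<^sup>+ y. \<integral>\<^sup>+ \<xi>. norm (?F y \<xi>) \<partial>lborel \<partial>lborel)"
    by (subst lborel.nn_integral_fst[symmetric]) (auto simp: cis_conv_exp)
  also have "\<dots> = (\<integral>\<^sup>+ y. \<integral>\<^sup>+ \<xi>. ennreal (norm (f y)) * ennreal (norm (gauss (\<xi> :: real ^ 'n))) \<partial>lborel \<partial>lborel)"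
    by (simp add: norm_mult ennreal_mult)
  also have "\<dots> = (\<integral>\<^sup>+ y. ennreal (norm (f y)) \<partial>lborel) * (\<integral>\<^sup>+ \<xi>. ennreal (norm (gauss (\<xi> :: real ^ 'n))) \<partial>lborel)"
    by (simp add: nn_integral_cmult nn_integral_multc)
  also have "\<dots> < \<infinity>"
    using f integrable_gauss[where 'a = "real ^ 'n"] by (auto simp: integrable_iff_bounded ennreal_mult_less_top)
  finally have int: "integrable (lborel \<Otimes>\<^sub>M lborel) (\<lambda>(y, \<xi>). ?F y \<xi>)"
    by (intro integrableI_bounded) (auto simp: cis_conv_exp)
  have "?c * complex_of_real (\<integral> y. f y * gauss (?w y) \<partial>lborel)
      = (\<integral> y. complex_of_real (f y) * (?c * complex_of_real (gauss (?w y))) \<partial>lborel)"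
    by (subst integral_complex_of_real[symmetric], subst integral_mult_right_zero[symmetric])
      (simp add: mult_ac)
  also have "\<dots> = (\<integral> y. \<integral> \<xi>. ?F y \<xi> \<partial>lborel \<partial>lborel)"
    by (simp only: integral_mult_right_zero gauss_transform of_real_mult)
  also have "\<dots> = (\<integral> \<xi>. \<integral> y. ?F y \<xi> \<partial>lborel \<partial>lborel)"
    by (rule lborel_pair.Fubini_integral[symmetric]) (use int in simp)
  also have "\<dots> = (\<integral> \<xi>. complex_of_real (gauss \<xi>) * cis (\<xi> \<bullet> ((1 / s) *\<^sub>R x)) * fourier f ((1 / s) *\<^sub>R \<xi>) \<partial>lborel)"
  proof (intro Bochner_Integration.integral_cong refl)
    fix \<xi> :: "real ^ 'n"
    have "?F y \<xi> = complex_of_real (gauss \<xi>) * cis (\<xi> \<bullet> ((1 / s) *\<^sub>R x)) * (cis (- ((1 / s) *\<^sub>R \<xi> \<bullet> y)) * complex_of_real (f y))" for y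
    proof -
      have "cis (\<xi> \<bullet> ?w y) = cis (\<xi> \<bullet> ((1 / s) *\<^sub>R x)) * cis (- ((1 / s) *\<^sub>R \<xi> \<bullet> y))"
        by (simp add: cis_mult inner_diff_right diff_divide_distrib)
      then show ?thesis by (simp only: mult_ac)
    qed
    then show "(\<integral> y. ?F y \<xi> \<partial>lborel) = complex_of_real (gauss \<xi>) * cis (\<xi> \<bullet> ((1 / s) *\<^sub>R x)) * fourier f ((1 / s) *\<^sub>R \<xi>)"
      unfolding fourier_def by (simp only: integral_mult_right_zero)
  qed
  finally have *: "(\<integral> y. f y * gauss (?w y) \<partial>lborel) = 0" by (simp add: zero)
  have "(\<integral> y. f y * gauss (?w y) \<partial>lborel) = (\<bar>- s\<bar> ^ DIM(real ^ 'n)) *\<^sub>R (\<integral> z. f (x + (- s) *\<^sub>R z) * gauss (?w (x + (- s) *\<^sub>R z)) \<partial>lborel)"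
    by (rule integral_lborel_affine) (use s in auto)
  then show ?thesis using * s by (simp add: mult.commute)
qed

text \<open>All Gaussian means of \<open>f\<close> vanish, and they converge to \<open>f\<close> in \<open>L^1\<close>.\<close>
lemma fourier_eq_0_imp_AE_0:
  fixes f :: "real ^ 'n \<Rightarrow> real"
  assumes f: "integrable lborel f" and zero: "\<And>\<xi>. fourier f \<xi> = 0"
  shows "AE x in lborel. f x = 0"
proof -
  have [measurable]: "f \<in> borel_measurable borel" using f by auto
  have fin: "(\<integral>\<^sup>+ x. ennreal (\<bar>f x\<bar> powr 1) \<partial>lborel) < \<infinity>"
    using f by (simp add: integrable_iff_bounded)
  have "(\<integral>\<^sup>+ x. ennreal \<bar>f x\<bar> \<partial>lborel)
    \<le> (\<integral>\<^sup>+ x. epow 1 (\<integral>\<^sup>+ z. ennreal \<bar>gauss z\<bar> * ennreal \<bar>f (x - (1 / Suc n) *\<^sub>R z) - f x\<bar> \<partial>lborel) \<partial>lborel)" for n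
  proof (intro nn_integral_mono)
    fix x
    have "ennreal \<bar>f x\<bar> \<le> (\<integral>\<^sup>+ z. ennreal \<bar>gauss z\<bar> * ennreal \<bar>f (x - (1 / Suc n) *\<^sub>R z) - f x\<bar> \<partial>lborel)"
      using mollification_error_le[OF _ integrable_gauss integral_gauss, of f x "1 / Suc n"]
      by (simp add: gauss_convolution_eq_0[OF f zero])
    from epow_mono[OF _ this, of 1] show "ennreal \<bar>f x\<bar>
        \<le> epow 1 (\<integral>\<^sup>+ z. ennreal \<bar>gauss z\<bar> * ennreal \<bar>f (x - (1 / Suc n) *\<^sub>R z) - f x\<bar> \<partial>lborel)"
      by (simp add: epow_ennreal)
  qed
  moreover have "(\<lambda>n. \<integral>\<^sup>+ x. epow 1 (\<integral>\<^sup>+ z. ennreal \<bar>gauss z\<bar> * ennreal \<bar>f (x - (1 / Suc n) *\<^sub>R z) - f x\<bar> \<partial>lborel) \<partial>lborel) \<longlonglongrightarrow> 0"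
    by (intro approximate_identity fin integrable_gauss LIMSEQ_Suc lim_1_over_n) auto
  ultimately have "(\<integral>\<^sup>+ x. ennreal \<bar>f x\<bar> \<partial>lborel) \<le> 0"
    by (intro LIMSEQ_le_const) auto
  then have "AE x in lborel. ennreal \<bar>f x\<bar> = 0" by (simp add: nn_integral_0_iff_AE)
  then show ?thesis by (simp add: ennreal_eq_0_iff)
qed

lemma fourier_inj:
  fixes f g :: "real ^ 'n \<Rightarrow> real"
  assumes f: "integrable lborel f" and g: "integrable lborel g" and eq: "\<And>\<xi>. fourier f \<xi> = fourier g \<xi>"
  shows "AE x in lborel. f x = g x"
proof -
  have int: "integrable lborel (\<lambda>x. cis (- (\<xi> \<bullet> x)) * complex_of_real (h x))" if h: "integrable lborel h" for h \<xi>
    using h by (intro Bochner_Integration.integrable_bound[OF h]) (auto simp: norm_mult cis_conv_exp)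
  have "fourier (\<lambda>x. f x - g x) \<xi> = 0" for \<xi>
    using eq[of \<xi>] int[OF f] int[OF g] unfolding fourier_def by (simp add: right_diff_distrib)
  then have "AE x in lborel. f x - g x = 0"
    by (intro fourier_eq_0_imp_AE_0 Bochner_Integration.integrable_diff f g)
  then show ?thesis by simp
qed

lemma fourier_dilate:
  fixes f :: "real ^ 'n \<Rightarrow> real"
  assumes f[measurable]: "f \<in> borel_measurable borel" and s: "0 < s"
  shows "fourier (\<lambda>x. f ((1 / s) *\<^sub>R x)) \<xi> = complex_of_real (s ^ CARD('n)) * fourier f (s *\<^sub>R \<xi>)"
proof -
  have "fourier (\<lambda>x. f ((1 / s) *\<^sub>R x)) \<xi> = (\<bar>s\<bar> ^ DIM(real ^ 'n)) *\<^sub>R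
    (\<integral> x. cis (- (\<xi> \<bullet> (0 + s *\<^sub>R x))) * complex_of_real (f ((1 / s) *\<^sub>R (0 + s *\<^sub>R x))) \<partial>lborel)"
    unfolding fourier_def by (rule integral_lborel_affine) (use s in \<open>auto simp: cis_conv_exp\<close>)
  then show ?thesis using s by (simp add: fourier_def scaleR_conv_of_real[where 'a = complex])
qed

text \<open>The transforms of both sides agree. In this way the explicit transforms of \<open>Z\<close> and \<open>Y\<close>, which depend
  on \<open>\<xi>\<close> only through \<open>|\<xi>|^(2 \<beta>) t^\<alpha>\<close>, show that each kernel at time \<open>t\<close> is a dilation of the kernel at
  time 1.\<close>
lemma self_similar_kernel:
  fixes k k1 :: "real ^ 'n \<Rightarrow> real"
  assumes k: "integrable lborel k" and k1: "integrable lborel k1" and s: "0 < s"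
    and eq: "\<And>\<xi>. fourier k \<xi> = complex_of_real c * fourier k1 (s *\<^sub>R \<xi>)"
  shows "AE x in lborel. k x = c / s ^ CARD('n) * k1 ((1 / s) *\<^sub>R x)"
proof (rule fourier_inj[OF k])
  have [measurable]: "k1 \<in> borel_measurable borel" using k1 by auto
  show "integrable lborel (\<lambda>x. c / s ^ CARD('n) * k1 ((1 / s) *\<^sub>R x))"
    using integrable_lborel_affine[OF k1, of "1 / s" 0] s by simp
  fix \<xi>
  have "fourier (\<lambda>x. c / s ^ CARD('n) * k1 ((1 / s) *\<^sub>R x)) \<xi>
      = complex_of_real (c / s ^ CARD('n)) * fourier (\<lambda>x. k1 ((1 / s) *\<^sub>R x)) \<xi>"
    unfolding fourier_def by (subst integral_mult_right_zero[symmetric]) (simp add: mult_ac)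
  then show "fourier k \<xi> = fourier (\<lambda>x. c / s ^ CARD('n) * k1 ((1 / s) *\<^sub>R x)) \<xi>"
    using s by (simp add: eq fourier_dilate)
qed

text \<open>Dilation does not change the \<open>L^1\<close> norm, so only the factor \<open>c\<close> remains: this controls the norms of the
  kernels at all times by those at time 1.\<close>
lemma nn_integral_self_similar:
  fixes k k1 :: "real ^ 'n \<Rightarrow> real"
  assumes [measurable]: "k1 \<in> borel_measurable borel" and s: "0 < s" and c: "0 \<le> c"
    and eq: "AE x in lborel. k x = c / s ^ CARD('n) * k1 ((1 / s) *\<^sub>R x)"
  shows "(\<integral>\<^sup>+ x. ennreal \<bar>k x\<bar> \<partial>lborel) = ennreal c * (\<integral>\<^sup>+ x. ennreal \<bar>k1 x\<bar> \<partial>lborel)"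
proof -
  have "(\<integral>\<^sup>+ x. ennreal \<bar>k x\<bar> \<partial>lborel) = (\<integral>\<^sup>+ x. ennreal (c / s ^ CARD('n)) * ennreal \<bar>k1 ((1 / s) *\<^sub>R x)\<bar> \<partial>lborel)"
    using eq by (intro nn_integral_cong_AE, eventually_elim) (use s c in \<open>auto simp: ennreal_mult[symmetric] abs_mult\<close>)
  also have "\<dots> = ennreal (\<bar>s\<bar> ^ DIM(real ^ 'n)) * (\<integral>\<^sup>+ x. ennreal (c / s ^ CARD('n)) * ennreal \<bar>k1 ((1 / s) *\<^sub>R (0 + s *\<^sub>R x))\<bar> \<partial>lborel)"
    by (rule nn_integral_lborel_affine) (use s in auto)
  also have "\<dots> = ennreal c * (\<integral>\<^sup>+ x. ennreal \<bar>k1 x\<bar> \<partial>lborel)"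
    using s c by (subst nn_integral_cmult) (auto simp: mult.assoc[symmetric] ennreal_mult[symmetric])
  finally show ?thesis .
qed

lemma integral_self_similar:
  fixes k k1 f :: "real ^ 'n \<Rightarrow> real"
  assumes [measurable]: "k \<in> borel_measurable borel" "k1 \<in> borel_measurable borel" "f \<in> borel_measurable borel"
    and s: "0 < s" and eq: "AE x in lborel. k x = 1 / s ^ CARD('n) * k1 ((1 / s) *\<^sub>R x)"
  shows "(\<integral> y. f y * k (x - y) \<partial>lborel) = (\<integral> z. k1 z * f (x - s *\<^sub>R z) \<partial>lborel)"
proof -
  have "(\<integral> y. f y * k (x - y) \<partial>lborel) = (\<bar>-1\<bar> ^ DIM(real ^ 'n)) *\<^sub>R
      (\<integral> z. f (x + (-1) *\<^sub>R z) * k (x - (x + (-1) *\<^sub>R z)) \<partial>lborel)"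
    by (rule integral_lborel_affine) auto
  also have "\<dots> = (\<integral> z. f (x - z) * k z \<partial>lborel)" by simp
  also have "\<dots> = (\<integral> z. f (x - z) * (1 / s ^ CARD('n) * k1 ((1 / s) *\<^sub>R z)) \<partial>lborel)"
    using eq by (intro integral_cong_AE) auto
  also have "\<dots> = (\<bar>s\<bar> ^ DIM(real ^ 'n)) *\<^sub>R
      (\<integral> z. f (x - (0 + s *\<^sub>R z)) * (1 / s ^ CARD('n) * k1 ((1 / s) *\<^sub>R (0 + s *\<^sub>R z))) \<partial>lborel)"
    by (rule integral_lborel_affine) (use s in auto)
  also have "\<dots> = (\<integral> z. k1 z * f (x - s *\<^sub>R z) \<partial>lborel)"
    using s by (subst integral_scaleR_right[symmetric]) (auto intro!: Bochner_Integration.integral_cong)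
  finally show ?thesis .
qed

section \<open>The Duhamel operator as a contraction\<close>

text \<open>A null set times the whole second space is a null set.\<close>
lemma AE_fst_pair:
  assumes M: "sigma_finite_measure M" and N: "sigma_finite_measure N" and Q: "AE x in M. Q x"
  shows "AE p in M \<Otimes>\<^sub>M N. Q (fst p)"
proof -
  interpret N: sigma_finite_measure N by fact
  obtain A where A: "{x \<in> space M. \<not> Q x} \<subseteq> A" "A \<in> sets M" "emeasure M A = 0"
    using Q by (auto elim: AE_E)
  have "A \<times> space N \<in> null_sets (M \<Otimes>\<^sub>M N)"
    using A by (auto simp: null_sets_def N.emeasure_pair_measure_Times)
  then show ?thesis
    by (rule AE_I') (use A in \<open>auto simp: space_pair_measure\<close>)
qed

lemma Lq_le_shift:
  fixes f :: "'a::euclidean_space \<Rightarrow> ennreal"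
  assumes f: "Lq_le lborel q D f" and [measurable]: "f \<in> borel_measurable borel"
  shows "Lq_le lborel q D (\<lambda>x. f (x - z))"
proof (cases "q = \<infinity>")
  case True
  let ?g = "\<lambda>x. if f x \<le> ennreal D then 0 else 1 :: ennreal"
  have "AE x in lborel. ?g x = 0" using f True by (simp add: Lq_le_def)
  then have "(\<integral>\<^sup>+ x. ?g x \<partial>lborel) = 0" by (subst nn_integral_0_iff_AE) auto
  then have "(\<integral>\<^sup>+ x. ?g (x - z) \<partial>lborel) = 0" by (subst nn_integral_lborel_shift) auto
  then have "AE x in lborel. ?g (x - z) = 0" by (subst (asm) nn_integral_0_iff_AE) auto
  then have "AE x in lborel. f (x - z) \<le> ennreal D" by eventually_elim (auto split: if_splits)
  then show ?thesis using True by (simp add: Lq_le_def)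
next
  case False
  then show ?thesis using f nn_integral_lborel_shift[of "\<lambda>x. epow (enn2real q) (f x)" z]
    by (simp add: Lq_le_def)
qed

text \<open>The Duhamel integral as one integral over space-time rather than an iterated one, so that it is
  defined by the same integrability condition that the notion of solution imposes.\<close>
definition duhamel :: "(real \<Rightarrow> 'a::euclidean_space \<Rightarrow> real) \<Rightarrow> (real \<Rightarrow> 'a \<Rightarrow> real) \<Rightarrow> real \<Rightarrow> 'a \<Rightarrow> real" where
  "duhamel k u t x =
     (LINT p:{0<..<t} \<times> UNIV|lborel. u (fst p) (snd p) * k (t - fst p) (x - snd p))"

text \<open>The Duhamel operator with the absolute value of the kernel, acting on nonnegative functions. It
  dominates \<open>duhamel\<close>, and its value at \<open>|u|\<close> is finite exactly where the
  Duhamel integral of \<open>u\<close> exists.\<close>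
definition duhamel_nn :: "(real \<Rightarrow> 'a::euclidean_space \<Rightarrow> real) \<Rightarrow> (real \<Rightarrow> 'a \<Rightarrow> ennreal) \<Rightarrow> real \<Rightarrow> 'a \<Rightarrow> ennreal" where
  "duhamel_nn k W t x =
     (\<integral>\<^sup>+ s. \<integral>\<^sup>+ y. indicator {0<..<t} s * (ennreal \<bar>k (t - s) (x - y)\<bar> * W s y) \<partial>lborel \<partial>lborel)"

abbreviation duhamel_integrable :: "(real \<Rightarrow> 'a::euclidean_space \<Rightarrow> real) \<Rightarrow> (real \<Rightarrow> 'a \<Rightarrow> real) \<Rightarrow> real \<Rightarrow> 'a \<Rightarrow> bool" where
  "duhamel_integrable k u t x \<equiv>
     set_integrable lborel ({0<..<t} \<times> UNIV) (\<lambda>p. u (fst p) (snd p) * k (t - fst p) (x - snd p))"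

lemma measurable_triangle [measurable]:
  assumes "f \<in> borel_measurable M" "g \<in> borel_measurable M"
  shows "(\<lambda>x. indicator {0<..<f x} (g x :: real) :: 'b::real_normed_algebra_1) \<in> borel_measurable M"
    "(\<lambda>x. indicator {0<..<f x} (g x) :: ennreal) \<in> borel_measurable M"
proof -
  note [measurable] = assms
  have [measurable]: "Measurable.pred M (\<lambda>x. 0 < g x \<and> g x < f x)" by measurable
  have "(\<lambda>x. if 0 < g x \<and> g x < f x then 1 else 0 :: 'b) \<in> borel_measurable M" by measurable
  then show "(\<lambda>x. indicator {0<..<f x} (g x :: real) :: 'b) \<in> borel_measurable M"
    by (simp add: indicator_def of_bool_def)
  have "(\<lambda>x. if 0 < g x \<and> g x < f x then 1 else 0 :: ennreal) \<in> borel_measurable M" by measurable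
  then show "(\<lambda>x. indicator {0<..<f x} (g x) :: ennreal) \<in> borel_measurable M"
    by (simp add: indicator_def of_bool_def)
qed

lemma measurable_duhamel_nn [measurable]:
  assumes [measurable]: "case_prod k \<in> borel_measurable (borel \<Otimes>\<^sub>M borel)"
    "case_prod W \<in> borel_measurable (borel \<Otimes>\<^sub>M borel)"
  shows "case_prod (duhamel_nn k W) \<in> borel_measurable (borel \<Otimes>\<^sub>M borel)"
  unfolding duhamel_nn_def by measurable

lemma duhamel_nn_mono:
  "(\<And>s y. 0 < s \<Longrightarrow> s < t \<Longrightarrow> W s y \<le> W' s y) \<Longrightarrow> duhamel_nn k W t x \<le> duhamel_nn k W' t x"
  unfolding duhamel_nn_def by (intro nn_integral_mono) (auto simp: indicator_def intro: mult_left_mono)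

lemma indicator_strip: "indicator ({0<..<t} \<times> UNIV) p = indicator {0<..<t} (fst p)"
  by (cases p) (auto simp: indicator_def)

lemma duhamel_integrand_measurable:
  fixes k u :: "real \<Rightarrow> 'a::euclidean_space \<Rightarrow> real"
  assumes [measurable]: "case_prod k \<in> borel_measurable (borel \<Otimes>\<^sub>M borel)"
    "case_prod u \<in> borel_measurable (borel \<Otimes>\<^sub>M borel)"
  shows "(\<lambda>p. indicator ({0<..<t} \<times> UNIV) p *\<^sub>R (u (fst p) (snd p) * k (t - fst p) (x - snd p)))
    \<in> borel_measurable (borel :: (real \<times> 'a) measure)"
  unfolding borel_prod[symmetric] indicator_strip by measurable

lemma measurable_duhamel [measurable]:
  fixes k u :: "real \<Rightarrow> 'a::euclidean_space \<Rightarrow> real"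
  assumes [measurable]: "case_prod k \<in> borel_measurable (borel \<Otimes>\<^sub>M borel)"
    "case_prod u \<in> borel_measurable (borel \<Otimes>\<^sub>M borel)"
  shows "case_prod (duhamel k u) \<in> borel_measurable (borel \<Otimes>\<^sub>M borel)"
  unfolding duhamel_def set_lebesgue_integral_def lborel_prod[symmetric] indicator_strip by measurable

lemma nn_integral_duhamel_integrand:
  fixes k u :: "real \<Rightarrow> 'a::euclidean_space \<Rightarrow> real"
  assumes [measurable]: "case_prod k \<in> borel_measurable (borel \<Otimes>\<^sub>M borel)"
    "case_prod W \<in> borel_measurable (borel \<Otimes>\<^sub>M borel)"
  shows "(\<integral>\<^sup>+ p. indicator ({0<..<t} \<times> UNIV) p * (ennreal \<bar>k (t - fst p) (x - snd p)\<bar> * W (fst p) (snd p)) \<partial>lborel)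
    = duhamel_nn k W t x"
  unfolding duhamel_nn_def lborel_prod[symmetric] indicator_strip
  by (subst lborel.nn_integral_fst[symmetric]) simp_all

lemma norm_duhamel_integrand:
  "ennreal (norm (indicator ({0<..<t} \<times> UNIV) p *\<^sub>R (u (fst p) (snd p) * k (t - fst p) (x - snd p))))
    = indicator ({0<..<t} \<times> UNIV) p * (ennreal \<bar>k (t - fst p) (x - snd p)\<bar> * ennreal \<bar>u (fst p) (snd p)\<bar>)"
  by (auto simp: indicator_def abs_mult ennreal_mult mult.commute)

lemma abs_duhamel_le:
  fixes k u :: "real \<Rightarrow> 'a::euclidean_space \<Rightarrow> real"
  assumes [measurable]: "case_prod k \<in> borel_measurable (borel \<Otimes>\<^sub>M borel)"
    "case_prod u \<in> borel_measurable (borel \<Otimes>\<^sub>M borel)"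
  shows "ennreal \<bar>duhamel k u t x\<bar> \<le> duhamel_nn k (\<lambda>s y. ennreal \<bar>u s y\<bar>) t x"
proof (cases "duhamel_integrable k u t x")
  case True
  have "ennreal \<bar>duhamel k u t x\<bar>
    \<le> (\<integral>\<^sup>+ p. ennreal (norm (indicator ({0<..<t} \<times> UNIV) p *\<^sub>R (u (fst p) (snd p) * k (t - fst p) (x - snd p)))) \<partial>lborel)"
    using integral_norm_bound_ennreal[OF True[unfolded set_integrable_def]]
    by (simp add: duhamel_def set_lebesgue_integral_def)
  then show ?thesis
    unfolding norm_duhamel_integrand by (subst (asm) nn_integral_duhamel_integrand) auto
next
  case False
  then show ?thesis
    by (simp add: duhamel_def set_lebesgue_integral_def set_integrable_def not_integrable_integral_eq)
qed

lemma duhamel_diff: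
  "duhamel_integrable k u t x \<Longrightarrow> duhamel_integrable k v t x \<Longrightarrow>
    duhamel k (\<lambda>s y. u s y - v s y) t x = duhamel k u t x - duhamel k v t x"
  unfolding duhamel_def by (subst set_integral_diff(2)[symmetric]) (auto simp: left_diff_distrib)

lemma duhamel_eq_iterated:
  fixes k u :: "real \<Rightarrow> 'a::euclidean_space \<Rightarrow> real"
  assumes "duhamel_integrable k u t x"
  shows "duhamel k u t x = (LINT s:{0<..<t}|lborel. LINT y|lborel. u s y * k (t - s) (x - y))"
proof -
  have "(\<integral> s. \<integral> y. indicator {0<..<t} s *\<^sub>R (u s y * k (t - s) (x - y)) \<partial>lborel \<partial>lborel) = duhamel k u t x"
    using lborel_pair.integral_fst'[of "\<lambda>p. indicator {0<..<t} (fst p) *\<^sub>R (u (fst p) (snd p) * k (t - fst p) (x - snd p))"] assms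
    by (simp add: duhamel_def set_integrable_def set_lebesgue_integral_def lborel_prod indicator_strip)
  then show ?thesis
    by (simp add: set_lebesgue_integral_def)
qed

text \<open>In the norm weighted by \<open>exp (- \<rho> t)\<close> the operator norm of the Duhamel operator is at most the weighted
  mass \<open>\<kappa>\<close> of the kernel. The proof reads the Duhamel integral as a superposition of the shifts of
  \<open>exp (- \<rho> s) W s\<close> with weights \<open>exp (\<rho> s) |k (t - s) z|\<close>.\<close>
lemma duhamel_nn_Lq_le:
  fixes k :: "real \<Rightarrow> 'a::euclidean_space \<Rightarrow> real"
  assumes k[measurable]: "case_prod k \<in> borel_measurable (borel \<Otimes>\<^sub>M borel)"
    and W[measurable]: "case_prod W \<in> borel_measurable (borel \<Otimes>\<^sub>M borel)"
    and q: "1 \<le> q" and C: "0 \<le> C" and \<kappa>: "0 < \<kappa>"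
    and mass: "(\<integral>\<^sup>+ \<sigma>. indicator {0<..<t} \<sigma> * (ennreal (exp (- \<rho> * \<sigma>)) * (\<integral>\<^sup>+ z. ennreal \<bar>k \<sigma> z\<bar> \<partial>lborel)) \<partial>lborel) \<le> ennreal \<kappa>"
    and bound: "AE s in lborel. 0 < s \<and> s < t \<longrightarrow> Lq_le lborel q (exp (\<rho> * s) * C) (W s)"
  shows "Lq_le lborel q (\<kappa> * exp (\<rho> * t) * C) (duhamel_nn k W t)"
proof -
  define K where "K p = indicator {0<..<t} (fst p) * (ennreal (exp (\<rho> * fst p)) * ennreal \<bar>k (t - fst p) (snd p)\<bar>)" for p :: "real \<times> 'a"
  define w where "w p x = ennreal (exp (- \<rho> * fst p)) * W (fst p) (x - snd p)" for p :: "real \<times> 'a" and x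
  have [measurable]: "K \<in> borel_measurable (lborel \<Otimes>\<^sub>M lborel)" unfolding K_def by measurable
  have [measurable]: "case_prod w \<in> borel_measurable ((lborel \<Otimes>\<^sub>M lborel) \<Otimes>\<^sub>M lborel)" unfolding w_def by measurable
  have SF: "sigma_finite_measure (lborel :: 'b::euclidean_space measure)" by standard
  have SF2: "sigma_finite_measure (lborel \<Otimes>\<^sub>M lborel :: (real \<times> 'a) measure)" by standard
  have "(\<integral>\<^sup>+ p. K p \<partial>(lborel \<Otimes>\<^sub>M lborel)) = (\<integral>\<^sup>+ s. \<integral>\<^sup>+ z. K (s, z) \<partial>lborel \<partial>lborel)"
    by (rule lborel.nn_integral_fst[symmetric]) measurable
  also have "\<dots> = (\<integral>\<^sup>+ s. indicator {0<..<t} s * (ennreal (exp (\<rho> * s)) * (\<integral>\<^sup>+ z. ennreal \<bar>k (t - s) z\<bar> \<partial>lborel)) \<partial>lborel)"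
    by (simp add: K_def nn_integral_cmult)
  also have "\<dots> = (\<integral>\<^sup>+ \<sigma>. indicator {0<..<t} (t - \<sigma>) * (ennreal (exp (\<rho> * (t - \<sigma>))) * (\<integral>\<^sup>+ z. ennreal \<bar>k (t - (t - \<sigma>)) z\<bar> \<partial>lborel)) \<partial>lborel)"
    by (rule nn_integral_lborel_reflect[symmetric]) measurable
  also have "\<dots> = (\<integral>\<^sup>+ \<sigma>. ennreal (exp (\<rho> * t)) * (indicator {0<..<t} \<sigma> * (ennreal (exp (- \<rho> * \<sigma>)) * (\<integral>\<^sup>+ z. ennreal \<bar>k \<sigma> z\<bar> \<partial>lborel))) \<partial>lborel)"
  proof (intro nn_integral_cong)
    fix \<sigma>
    have "ennreal (exp (\<rho> * (t - \<sigma>))) = ennreal (exp (\<rho> * t)) * ennreal (exp (- \<rho> * \<sigma>))"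
      by (simp add: ennreal_mult[symmetric] exp_add[symmetric] algebra_simps)
    then show "indicator {0<..<t} (t - \<sigma>) * (ennreal (exp (\<rho> * (t - \<sigma>))) * (\<integral>\<^sup>+ z. ennreal \<bar>k (t - (t - \<sigma>)) z\<bar> \<partial>lborel))
      = ennreal (exp (\<rho> * t)) * (indicator {0<..<t} \<sigma> * (ennreal (exp (- \<rho> * \<sigma>)) * (\<integral>\<^sup>+ z. ennreal \<bar>k \<sigma> z\<bar> \<partial>lborel)))"
      by (auto simp: indicator_def mult.assoc)
  qed
  also have "\<dots> = ennreal (exp (\<rho> * t)) * (\<integral>\<^sup>+ \<sigma>. indicator {0<..<t} \<sigma> * (ennreal (exp (- \<rho> * \<sigma>)) * (\<integral>\<^sup>+ z. ennreal \<bar>k \<sigma> z\<bar> \<partial>lborel)) \<partial>lborel)"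
    by (rule nn_integral_cmult) measurable
  also have "\<dots> \<le> ennreal (exp (\<rho> * t)) * ennreal \<kappa>" by (intro mult_left_mono mass) auto
  finally have K_mass: "(\<integral>\<^sup>+ p. K p \<partial>(lborel \<Otimes>\<^sub>M lborel)) \<le> ennreal (\<kappa> * exp (\<rho> * t))"
    using \<kappa> by (simp add: ennreal_mult[symmetric] mult.commute)
  have "AE p in lborel \<Otimes>\<^sub>M lborel. 0 < fst p \<and> fst p < t \<longrightarrow> Lq_le lborel q (exp (\<rho> * fst p) * C) (W (fst p))"
    by (rule AE_fst_pair[OF SF SF bound])
  then have "AE p in lborel \<Otimes>\<^sub>M lborel. K p \<noteq> 0 \<longrightarrow> Lq_le lborel q C (w p)"
  proof eventually_elim
    case (elim p)
    show ?case
    proof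
      assume "K p \<noteq> 0"
      then have "Lq_le lborel q (exp (\<rho> * fst p) * C) (W (fst p))"
        using elim by (auto simp: K_def indicator_def split: if_splits)
      then have "Lq_le lborel q (exp (- \<rho> * fst p) * (exp (\<rho> * fst p) * C)) (w p)"
        unfolding w_def by (intro Lq_le_cmult Lq_le_shift q) (use C in auto)
      then show "Lq_le lborel q C (w p)" by (simp add: mult.assoc[symmetric] exp_add[symmetric])
    qed
  qed
  then have "Lq_le lborel q (\<kappa> * exp (\<rho> * t) * C) (\<lambda>x. \<integral>\<^sup>+ p. K p * w p x \<partial>(lborel \<Otimes>\<^sub>M lborel))"
    by (intro Lq_le_nn_integral[OF SF2 SF q _ _ K_mass _ C]) (use \<kappa> in auto)
  moreover have "(\<integral>\<^sup>+ p. K p * w p x \<partial>(lborel \<Otimes>\<^sub>M lborel)) = duhamel_nn k W t x" for x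
  proof -
    have "(\<integral>\<^sup>+ p. K p * w p x \<partial>(lborel \<Otimes>\<^sub>M lborel)) = (\<integral>\<^sup>+ s. \<integral>\<^sup>+ z. K (s, z) * w (s, z) x \<partial>lborel \<partial>lborel)"
      by (rule lborel.nn_integral_fst[symmetric]) measurable
    also have "\<dots> = (\<integral>\<^sup>+ s. \<integral>\<^sup>+ z. indicator {0<..<t} s * (ennreal \<bar>k (t - s) (x - (x - z))\<bar> * W s (x - z)) \<partial>lborel \<partial>lborel)"
    proof (intro nn_integral_cong)
      fix s z
      have "K (s, z) * w (s, z) x = indicator {0<..<t} s *
          (ennreal \<bar>k (t - s) z\<bar> * ((ennreal (exp (\<rho> * s)) * ennreal (exp (- \<rho> * s))) * W s (x - z)))"
        by (simp only: K_def w_def fst_conv snd_conv mult_ac)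
      also have "ennreal (exp (\<rho> * s)) * ennreal (exp (- \<rho> * s)) = 1"
        by (simp add: ennreal_mult[symmetric] exp_add[symmetric])
      finally show "K (s, z) * w (s, z) x = indicator {0<..<t} s * (ennreal \<bar>k (t - s) (x - (x - z))\<bar> * W s (x - z))"
        by simp
    qed
    also have "\<dots> = duhamel_nn k W t x"
      unfolding duhamel_nn_def
    proof (rule nn_integral_cong)
      fix s
      show "(\<integral>\<^sup>+ z. indicator {0<..<t} s * (ennreal \<bar>k (t - s) (x - (x - z))\<bar> * W s (x - z)) \<partial>lborel)
        = (\<integral>\<^sup>+ y. indicator {0<..<t} s * (ennreal \<bar>k (t - s) (x - y)\<bar> * W s y) \<partial>lborel)"
        by (rule nn_integral_lborel_reflect[of "\<lambda>y. indicator {0<..<t} s * (ennreal \<bar>k (t - s) (x - y)\<bar> * W s y)" x]) measurable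
    qed
    finally show ?thesis .
  qed
  ultimately show ?thesis by simp
qed

text \<open>A kernel whose Duhamel operator is a contraction with constant 1/2 on the whole half-line for the
  weight \<open>exp (- \<rho> t)\<close>.\<close>
locale contractive_kernel =
  fixes k :: "real \<Rightarrow> 'a::euclidean_space \<Rightarrow> real" and \<rho> :: real
  assumes measurable_k [measurable]: "case_prod k \<in> borel_measurable (borel \<Otimes>\<^sub>M borel)"
    and rate_nonneg: "0 \<le> \<rho>"
    and weighted_mass: "(\<integral>\<^sup>+ \<sigma>. indicator {0<..} \<sigma> * (ennreal (exp (- \<rho> * \<sigma>)) * (\<integral>\<^sup>+ z. ennreal \<bar>k \<sigma> z\<bar> \<partial>lborel)) \<partial>lborel) \<le> ennreal (1 / 2)"
begin

lemma duhamel_nn_halves: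
  assumes [measurable]: "case_prod W \<in> borel_measurable (borel \<Otimes>\<^sub>M borel)"
    and q: "1 \<le> q" and C: "0 \<le> C"
    and bound: "AE s in lborel. 0 < s \<and> s < t \<longrightarrow> Lq_le lborel q (exp (\<rho> * s) * C) (W s)"
  shows "Lq_le lborel q (exp (\<rho> * t) * (C / 2)) (duhamel_nn k W t)"
proof -
  have "(\<integral>\<^sup>+ \<sigma>. indicator {0<..<t} \<sigma> * (ennreal (exp (- \<rho> * \<sigma>)) * (\<integral>\<^sup>+ z. ennreal \<bar>k \<sigma> z\<bar> \<partial>lborel)) \<partial>lborel)
    \<le> (\<integral>\<^sup>+ \<sigma>. indicator {0<..} \<sigma> * (ennreal (exp (- \<rho> * \<sigma>)) * (\<integral>\<^sup>+ z. ennreal \<bar>k \<sigma> z\<bar> \<partial>lborel)) \<partial>lborel)"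
    by (intro nn_integral_mono mult_right_mono) (auto simp: indicator_def)
  also note weighted_mass
  finally have "Lq_le lborel q (1 / 2 * exp (\<rho> * t) * C) (duhamel_nn k W t)"
    by (intro duhamel_nn_Lq_le[OF measurable_k _ q C _ _ bound]) auto
  then show ?thesis by (simp add: mult_ac)
qed

text \<open>The mass of the kernel on \<open>(0, t)\<close> tends to 0 with \<open>t\<close> because the mass on the half-line is finite. Hence
  the Duhamel term of a function that is bounded in \<open>L^q\<close> tends to 0 as well.\<close>
lemma duhamel_nn_small_time:
  assumes q: "1 \<le> q" and C: "0 \<le> C" and e: "0 < e"
  obtains \<delta> where "0 < \<delta>"
    "\<And>W t. case_prod W \<in> borel_measurable (borel \<Otimes>\<^sub>M borel) \<Longrightarrow> 0 < t \<Longrightarrow> t < \<delta> \<Longrightarrow>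
       (AE s in lborel. 0 < s \<and> s < t \<longrightarrow> Lq_le lborel q C (W s)) \<Longrightarrow> Lq_le lborel q e (duhamel_nn k W t)"
proof -
  define g where "g \<sigma> = ennreal (exp (- \<rho> * \<sigma>)) * (\<integral>\<^sup>+ z. ennreal \<bar>k \<sigma> z\<bar> \<partial>lborel)" for \<sigma>
  have [measurable]: "g \<in> borel_measurable borel" unfolding g_def by measurable
  define \<kappa> where "\<kappa> = e / (exp \<rho> * (C + 1))"
  have \<kappa>: "0 < \<kappa>" using e C by (simp add: \<kappa>_def add_nonneg_pos)
  have "\<kappa> * exp \<rho> * (C + 1) = e" using C by (simp add: \<kappa>_def)
  then have \<kappa>_le: "\<kappa> * exp \<rho> * C \<le> e" using mult_pos_pos[OF \<kappa> exp_gt_zero[of \<rho>]] by (simp add: distrib_left)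
  have "(\<lambda>n. \<integral>\<^sup>+ \<sigma>. indicator {0<..<1 / Suc n} \<sigma> * g \<sigma> \<partial>lborel) \<longlonglongrightarrow> (\<integral>\<^sup>+ \<sigma>. 0 \<partial>(lborel :: real measure))"
  proof (rule nn_integral_dominated_convergence[where w = "\<lambda>\<sigma>. indicator {0<..} \<sigma> * g \<sigma>"])
    show "(\<integral>\<^sup>+ \<sigma>. indicator {0<..} \<sigma> * g \<sigma> \<partial>lborel) < \<infinity>"
      unfolding g_def infinity_ennreal_def by (rule le_less_trans[OF weighted_mass ennreal_less_top])
    show "AE \<sigma> in lborel. (\<lambda>n. indicator {0<..<1 / Suc n} \<sigma> * g \<sigma>) \<longlonglongrightarrow> 0"
    proof (intro AE_I2)
      fix \<sigma> :: real
      show "(\<lambda>n. indicator {0<..<1 / Suc n} \<sigma> * g \<sigma>) \<longlonglongrightarrow> 0"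
      proof (cases "0 < \<sigma>")
        case True
        have "(\<lambda>n. 1 / real (Suc n)) \<longlonglongrightarrow> 0" by (intro LIMSEQ_Suc lim_1_over_n)
        then have "\<forall>\<^sub>F n in sequentially. 1 / real (Suc n) < \<sigma>" using True by (rule order_tendstoD)
        then have "\<forall>\<^sub>F n in sequentially. indicator {0<..<1 / Suc n} \<sigma> * g \<sigma> = 0" by eventually_elim auto
        then show ?thesis by (rule tendsto_eventually)
      qed simp
    qed
  qed (auto simp: indicator_def)
  then have "(\<lambda>n. \<integral>\<^sup>+ \<sigma>. indicator {0<..<1 / Suc n} \<sigma> * g \<sigma> \<partial>lborel) \<longlonglongrightarrow> 0" by simp
  then have "\<forall>\<^sub>F n in sequentially. (\<integral>\<^sup>+ \<sigma>. indicator {0<..<1 / Suc n} \<sigma> * g \<sigma> \<partial>lborel) < ennreal \<kappa>"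
    using \<kappa> by (intro order_tendstoD) auto
  then obtain n where n: "(\<integral>\<^sup>+ \<sigma>. indicator {0<..<1 / Suc n} \<sigma> * g \<sigma> \<partial>lborel) < ennreal \<kappa>"
    by (auto simp: eventually_sequentially)
  show ?thesis
  proof (rule that[of "1 / Suc n"])
    fix W :: "real \<Rightarrow> 'a \<Rightarrow> ennreal" and t :: real
    assume [measurable]: "case_prod W \<in> borel_measurable (borel \<Otimes>\<^sub>M borel)"
      and t: "0 < t" "t < 1 / Suc n"
      and W: "AE s in lborel. 0 < s \<and> s < t \<longrightarrow> Lq_le lborel q C (W s)"
    have "(\<integral>\<^sup>+ \<sigma>. indicator {0<..<t} \<sigma> * g \<sigma> \<partial>lborel) \<le> (\<integral>\<^sup>+ \<sigma>. indicator {0<..<1 / Suc n} \<sigma> * g \<sigma> \<partial>lborel)"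
      using t by (intro nn_integral_mono mult_right_mono) (auto simp: indicator_def)
    then have mass: "(\<integral>\<^sup>+ \<sigma>. indicator {0<..<t} \<sigma> * (ennreal (exp (- \<rho> * \<sigma>)) * (\<integral>\<^sup>+ z. ennreal \<bar>k \<sigma> z\<bar> \<partial>lborel)) \<partial>lborel) \<le> ennreal \<kappa>"
      using n unfolding g_def by (auto intro: order_trans less_imp_le)
    have "AE s in lborel. 0 < s \<and> s < t \<longrightarrow> Lq_le lborel q (exp (\<rho> * s) * C) (W s)"
      using W
    proof eventually_elim
      case (elim s)
      show ?case
      proof
        assume s: "0 < s \<and> s < t"
        then have "1 * C \<le> exp (\<rho> * s) * C" using rate_nonneg C by (intro mult_right_mono) auto
        then show "Lq_le lborel q (exp (\<rho> * s) * C) (W s)"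
          using elim s C by (auto intro: Lq_le_mono[of lborel q C "W s"])
      qed
    qed
    then have le: "Lq_le lborel q (\<kappa> * exp (\<rho> * t) * C) (duhamel_nn k W t)"
      by (intro duhamel_nn_Lq_le[OF measurable_k _ q C \<kappa> mass]) auto
    have le_e: "\<kappa> * exp (\<rho> * t) * C \<le> e"
    proof -
      have "1 / real (Suc n) \<le> 1" by simp
      then have "t \<le> 1" using t by linarith
      then have "exp (\<rho> * t) \<le> exp \<rho>" using rate_nonneg by (simp add: mult_left_le)
      then have "\<kappa> * exp (\<rho> * t) * C \<le> \<kappa> * exp \<rho> * C"
        using \<kappa> C by (intro mult_right_mono mult_left_mono) auto
      with \<kappa>_le show ?thesis by simp
    qed
    show "Lq_le lborel q e (duhamel_nn k W t)"
      by (rule Lq_le_mono[OF le _ _ le_e]) (use \<kappa> C in auto)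
  qed simp
qed

text \<open>Each application of the contraction halves the weighted norm of a subsolution, so this norm is 0.\<close>
lemma duhamel_subsolution_eq_0:
  assumes W[measurable]: "case_prod W \<in> borel_measurable (borel \<Otimes>\<^sub>M borel)"
    and q: "1 \<le> q" and C: "0 \<le> C"
    and bound: "AE t in lborel. 0 < t \<and> t < T \<longrightarrow> Lq_le lborel q C (W t)"
    and sub: "AE t in lborel. 0 < t \<and> t < T \<longrightarrow> (AE x in lborel. W t x \<le> duhamel_nn k W t x)"
  shows "AE t in lborel. 0 < t \<and> t < T \<longrightarrow> (AE x in lborel. W t x = 0)"
proof -
  have iter: "AE t in lborel. 0 < t \<and> t < T \<longrightarrow> Lq_le lborel q (exp (\<rho> * t) * (C / 2 ^ n)) (W t)" for n
  proof (induction n)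
    case 0
    show ?case using bound
    proof eventually_elim
      case (elim t)
      show ?case
      proof
        assume t: "0 < t \<and> t < T"
        then have "1 * C \<le> exp (\<rho> * t) * C" using rate_nonneg C by (intro mult_right_mono) auto
        then show "Lq_le lborel q (exp (\<rho> * t) * (C / 2 ^ 0)) (W t)"
          using elim t C by (auto intro: Lq_le_mono[of lborel q C "W t"])
      qed
    qed
  next
    case (Suc n)
    have step: "Lq_le lborel q (exp (\<rho> * t) * (C / 2 ^ n / 2)) (duhamel_nn k W t)" if "t < T" for t
      by (rule duhamel_nn_halves[OF W q]) (use C Suc that in \<open>auto elim!: eventually_mono\<close>)
    show ?case using sub
    proof eventually_elim
      case (elim t)
      show ?case
      proof
        assume t: "0 < t \<and> t < T"
        then show "Lq_le lborel q (exp (\<rho> * t) * (C / 2 ^ Suc n)) (W t)"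
          using Lq_le_mono[OF step[of t], of "W t"] elim C by (auto simp: mult.commute)
      qed
    qed
  qed
  then have "AE t in lborel. \<forall>n. 0 < t \<and> t < T \<longrightarrow> Lq_le lborel q (exp (\<rho> * t) * (C / 2 ^ n)) (W t)"
    by (subst AE_all_countable) blast
  then show ?thesis
  proof eventually_elim
    case (elim t)
    have "(\<lambda>n. exp (\<rho> * t) * (C * (1 / 2) ^ n)) \<longlonglongrightarrow> exp (\<rho> * t) * (C * 0)"
      by (intro tendsto_intros LIMSEQ_realpow_zero) auto
    then have lim: "(\<lambda>n. exp (\<rho> * t) * (C / 2 ^ n)) \<longlonglongrightarrow> 0" by (simp add: power_one_over)
    show ?case
    proof
      assume "0 < t \<and> t < T"
      with elim show "AE x in lborel. W t x = 0"
        by (intro Lq_le_imp_AE_0[OF _ lim _ q]) (use C in auto)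
    qed
  qed
qed

text \<open>The solution is the Neumann series \<open>u = d 0 + d 1 + ...\<close> with \<open>d 0 = z\<close> and \<open>d (n + 1)\<close> the Duhamel term of
  \<open>d n\<close>. The absolute values are dominated by the iterates \<open>v n\<close> of the operator on nonnegative functions,
  whose weighted norms decay like \<open>2^(-n)\<close>; so their sum \<open>V\<close> and the image of \<open>V\<close> have finite norms.
  Wherever \<open>V\<close> and its image are finite, hence almost everywhere at each time, the series may be
  integrated term by term against the kernel, which gives the integral equation.\<close>
lemma duhamel_solution_exists:
  fixes z :: "real \<Rightarrow> 'a \<Rightarrow> real"
  assumes z[measurable]: "case_prod z \<in> borel_measurable (borel \<Otimes>\<^sub>M borel)"
    and q: "1 \<le> q" and M: "0 < M"
    and bound: "\<And>t. 0 < t \<Longrightarrow> Lq_le lborel q (exp (\<rho> * t) * M) (\<lambda>x. ennreal \<bar>z t x\<bar>)"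
  obtains u where "case_prod u \<in> borel_measurable (borel \<Otimes>\<^sub>M borel)"
    "\<And>t. 0 < t \<Longrightarrow> Lq_le lborel q (exp (\<rho> * t) * (2 * M)) (\<lambda>x. ennreal \<bar>u t x\<bar>)"
    "\<And>t. 0 < t \<Longrightarrow> AE x in lborel. duhamel_integrable k u t x \<and> u t x = z t x + duhamel k u t x"
proof -
  have SF: "sigma_finite_measure (lborel :: 'a measure)" by standard
  define d where "d n = (duhamel k ^^ n) z" for n
  define v where "v n = (duhamel_nn k ^^ n) (\<lambda>t x. ennreal \<bar>z t x\<bar>)" for n
  define V where "V t x = (\<Sum>n. v n t x)" for t x
  define u where "u t x = (\<Sum>n. d n t x)" for t x
  have d_simps: "d 0 = z" "d (Suc n) = duhamel k (d n)" for n by (auto simp: d_def)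
  have v_simps: "v 0 = (\<lambda>t x. ennreal \<bar>z t x\<bar>)" "v (Suc n) = duhamel_nn k (v n)" for n by (auto simp: v_def)
  have d_meas[measurable]: "case_prod (d n) \<in> borel_measurable (borel \<Otimes>\<^sub>M borel)" for n
    by (induction n) (auto simp: d_simps intro: measurable_duhamel)
  have v_meas[measurable]: "case_prod (v n) \<in> borel_measurable (borel \<Otimes>\<^sub>M borel)" for n
  proof (induction n)
    case 0
    show ?case unfolding v_simps by measurable
  qed (auto simp: v_simps intro: measurable_duhamel_nn)
  have V_meas[measurable]: "case_prod V \<in> borel_measurable (borel \<Otimes>\<^sub>M borel)" unfolding V_def by measurable
  have u_meas[measurable]: "case_prod u \<in> borel_measurable (borel \<Otimes>\<^sub>M borel)" unfolding u_def by measurable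
  have d_le: "ennreal \<bar>d n t x\<bar> \<le> v n t x" for n t x
  proof (induction n arbitrary: t x)
    case 0
    show ?case by (simp add: d_simps v_simps)
  next
    case (Suc n)
    have "ennreal \<bar>d (Suc n) t x\<bar> \<le> duhamel_nn k (\<lambda>s y. ennreal \<bar>d n s y\<bar>) t x"
      by (simp add: d_simps abs_duhamel_le)
    also have "\<dots> \<le> v (Suc n) t x" unfolding v_simps by (intro duhamel_nn_mono Suc)
    finally show ?case .
  qed
  have v_bound: "0 < t \<Longrightarrow> Lq_le lborel q (exp (\<rho> * t) * (M / 2 ^ n)) (v n t)" for n t
  proof (induction n arbitrary: t)
    case 0
    then show ?case using bound by (simp add: v_simps)
  next
    case (Suc n)
    have "Lq_le lborel q (exp (\<rho> * t) * (M / 2 ^ n / 2)) (duhamel_nn k (v n) t)"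
      by (rule duhamel_nn_halves[OF v_meas q]) (use M Suc in auto)
    then show ?case by (simp add: v_simps mult.commute)
  qed
  have V_bound: "Lq_le lborel q (exp (\<rho> * t) * (2 * M)) (V t)" if t: "0 < t" for t
  proof -
    have geo: "(\<lambda>n. exp (\<rho> * t) * (M / 2 ^ n)) sums (exp (\<rho> * t) * (M * 2))"
      using sums_mult[OF geometric_sums[of "1 / 2 :: real"], of "exp (\<rho> * t) * M"]
      by (simp add: power_one_over mult.assoc)
    have "(\<Sum>n. ennreal (exp (\<rho> * t) * (M / 2 ^ n))) = ennreal (exp (\<rho> * t) * (M * 2))"
      using geo M by (intro suminf_ennreal_eq) auto
    then have "Lq_le lborel q (exp (\<rho> * t) * (2 * M)) (\<lambda>x. \<integral>\<^sup>+ n. v n t x \<partial>count_space UNIV)"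
      using M v_bound[OF t]
      by (intro Lq_le_sum[OF SF q, where a = "\<lambda>n. exp (\<rho> * t) * (M / 2 ^ n)"]) (auto simp: nn_integral_count_space_nat mult.commute)
    then show ?thesis by (simp add: V_def[abs_def] nn_integral_count_space_nat)
  qed
  have summable: "summable (\<lambda>n. norm (d n t x))" "ennreal \<bar>u t x\<bar> \<le> V t x" if fin: "V t x < \<infinity>" for t x
  proof -
    have le: "(\<Sum>n. ennreal \<bar>d n t x\<bar>) \<le> V t x" unfolding V_def by (intro suminf_le d_le) auto
    then have "(\<Sum>n. ennreal \<bar>d n t x\<bar>) \<noteq> \<top>" using fin by (auto simp: top_unique)
    then show s: "summable (\<lambda>n. norm (d n t x))" by (intro summable_suminf_not_top) auto
    have "ennreal \<bar>u t x\<bar> \<le> ennreal (\<Sum>n. norm (d n t x))"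
      using summable_norm[OF s] by (intro ennreal_leI) (simp add: u_def)
    also have "\<dots> = (\<Sum>n. ennreal \<bar>d n t x\<bar>)" using s by (subst suminf_ennreal2) auto
    finally show "ennreal \<bar>u t x\<bar> \<le> V t x" using le by (rule order_trans)
  qed
  have V_fin: "AE x in lborel. V t x < \<infinity>" if "0 < t" for t
    by (rule Lq_le_imp_finite[OF V_bound[OF that]]) measurable
  have DV_fin: "AE x in lborel. duhamel_nn k V t x < \<infinity>" if "0 < t" for t
    by (rule Lq_le_imp_finite[OF duhamel_nn_halves[OF V_meas q, of "2 * M"]])
      (use M V_bound in auto)
  show ?thesis
  proof (rule that[OF u_meas])
    fix t :: real assume t: "0 < t"
    show "Lq_le lborel q (exp (\<rho> * t) * (2 * M)) (\<lambda>x. ennreal \<bar>u t x\<bar>)"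
      by (rule Lq_le_mono[OF V_bound[OF t]])
        (use V_fin[OF t] summable(2) M in \<open>auto elim!: eventually_mono\<close>)
    show "AE x in lborel. duhamel_integrable k u t x \<and> u t x = z t x + duhamel k u t x"
      using V_fin[OF t] DV_fin[OF t]
    proof eventually_elim
      case (elim x)
      let ?A = "{0<..<t} \<times> (UNIV :: 'a set)"
      let ?f = "\<lambda>n p. indicator ?A p *\<^sub>R (d n (fst p) (snd p) * k (t - fst p) (x - snd p))"
      have fm: "?f n \<in> borel_measurable borel" for n
        by (rule duhamel_integrand_measurable[OF measurable_k d_meas])
      have W_meas[measurable]: "(\<lambda>p. indicator ?A p * (ennreal \<bar>k (t - fst p) (x - snd p)\<bar> * W (fst p) (snd p))) \<in> borel_measurable lborel"
        if [measurable]: "case_prod W \<in> borel_measurable (borel \<Otimes>\<^sub>M borel)" for W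
        unfolding lborel_prod[symmetric] indicator_strip by measurable
      have nn: "(\<integral>\<^sup>+ p. norm (?f n p) \<partial>lborel) \<le> duhamel_nn k (v n) t x" for n
        unfolding norm_duhamel_integrand
        by (subst nn_integral_duhamel_integrand) (auto intro!: duhamel_nn_mono d_le)
      have V_sum: "duhamel_nn k V t x = (\<Sum>n. duhamel_nn k (v n) t x)"
      proof -
        have "duhamel_nn k V t x = (\<integral>\<^sup>+ p. (\<Sum>n. indicator ?A p * (ennreal \<bar>k (t - fst p) (x - snd p)\<bar> * v n (fst p) (snd p))) \<partial>lborel)"
          by (subst nn_integral_duhamel_integrand[symmetric]) (auto simp: V_def)
        also have "\<dots> = (\<Sum>n. duhamel_nn k (v n) t x)"
          by (subst nn_integral_suminf) (auto simp: nn_integral_duhamel_integrand)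
        finally show ?thesis .
      qed
      have "(\<Sum>n. \<integral>\<^sup>+ p. norm (?f n p) \<partial>lborel) \<le> duhamel_nn k V t x"
        unfolding V_sum by (intro suminf_le nn) auto
      then have sum_fin: "(\<Sum>n. \<integral>\<^sup>+ p. norm (?f n p) \<partial>lborel) < \<infinity>" using elim by (auto intro: le_less_trans)
      have int: "integrable lborel (?f n)" for n
      proof -
        have "duhamel_nn k (v n) t x \<le> duhamel_nn k V t x"
        proof (rule duhamel_nn_mono)
          fix s y
          show "v n s y \<le> V s y" using sum_le_suminf[of "\<lambda>n. v n s y" "{n}"] by (simp add: V_def)
        qed
        then show ?thesis using nn[of n] elim fm[of n]
          by (intro integrableI_bounded) (auto intro: le_less_trans)
      qed
      have "AE p in lborel. indicator ?A p * (ennreal \<bar>k (t - fst p) (x - snd p)\<bar> * V (fst p) (snd p)) \<noteq> \<infinity>"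
        using elim by (intro nn_integral_noteq_infinite) (auto simp: nn_integral_duhamel_integrand)
      \<comment> \<open>Where the kernel is nonzero, finiteness of the integrand forces \<open>V\<close> to be finite there;
        where it is zero, so are all terms of the series.\<close>
      then have AE_sum: "AE p in lborel. summable (\<lambda>n. norm (?f n p))"
      proof eventually_elim
        case (elim p)
        show ?case
        proof (cases "p \<in> ?A \<and> k (t - fst p) (x - snd p) \<noteq> 0")
          case True
          then have "V (fst p) (snd p) < \<infinity>"
            using elim by (auto simp: indicator_def ennreal_mult_eq_top_iff less_top)
          then show ?thesis using True
            by (auto simp: abs_mult intro!: summable_mult2 summable(1)[unfolded real_norm_def])
        next
          case False
          then have zero: "norm (?f n p) = 0" for n by auto
          show ?thesis unfolding zero by simp
        qed
      qed
      have sumI: "summable (\<lambda>n. \<integral> p. norm (?f n p) \<partial>lborel)"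
      proof (rule summable_suminf_not_top)
        show "(\<Sum>n. ennreal (\<integral> p. norm (?f n p) \<partial>lborel)) \<noteq> \<top>"
          using sum_fin int by (subst nn_integral_eq_integral[symmetric]) auto
      qed auto
      have u_eq: "(\<Sum>n. ?f n p) = indicator ?A p *\<^sub>R (u (fst p) (snd p) * k (t - fst p) (x - snd p))"
        if "summable (\<lambda>n. norm (?f n p))" for p
      proof (cases "p \<in> ?A \<and> k (t - fst p) (x - snd p) \<noteq> 0")
        case True
        have "summable (\<lambda>n. ?f n p)" using that by (rule summable_norm_cancel)
        then have "summable (\<lambda>n. d n (fst p) (snd p))"
          using summable_divide[of "\<lambda>n. d n (fst p) (snd p) * k (t - fst p) (x - snd p)" "k (t - fst p) (x - snd p)"] True
          by simp
        then show ?thesis using True by (simp add: u_def suminf_mult2)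
      qed auto
      have u_eq': "AE p in lborel. (\<Sum>n. ?f n p) = indicator ?A p *\<^sub>R (u (fst p) (snd p) * k (t - fst p) (x - snd p))"
        using AE_sum by eventually_elim (rule u_eq)
      have um: "(\<lambda>p. indicator ?A p *\<^sub>R (u (fst p) (snd p) * k (t - fst p) (x - snd p))) \<in> borel_measurable lborel"
        using duhamel_integrand_measurable[OF measurable_k u_meas, of t x] by simp
      have sm: "(\<lambda>p. \<Sum>n. ?f n p) \<in> borel_measurable lborel"
        using fm by (intro borel_measurable_suminf) auto
      have "integrable lborel (\<lambda>p. \<Sum>n. ?f n p)" by (rule integrable_suminf[OF int AE_sum sumI])
      then have int_u: "duhamel_integrable k u t x"
        unfolding set_integrable_def using u_eq' by (subst (asm) integrable_cong_AE[OF sm um]) auto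
      have "duhamel k u t x = (\<integral> p. (\<Sum>n. ?f n p) \<partial>lborel)"
        unfolding duhamel_def set_lebesgue_integral_def
        by (intro integral_cong_AE um sm) (use u_eq' in \<open>auto elim!: eventually_mono\<close>)
      also have "\<dots> = (\<Sum>n. d (Suc n) t x)"
        unfolding integral_suminf[OF int AE_sum sumI] d_simps duhamel_def set_lebesgue_integral_def ..
      finally have "z t x + duhamel k u t x = u t x"
        using suminf_split_head[OF summable_norm_cancel[OF summable(1)]] elim
        by (simp add: u_def d_simps(1))
      then show ?case using int_u by simp
    qed
  qed
qed

end

section \<open>The linear Cauchy problem\<close>

lemma convolution_Lq_le:
  fixes f K :: "'a::euclidean_space \<Rightarrow> real"
  assumes [measurable]: "f \<in> borel_measurable borel" "K \<in> borel_measurable borel"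
    and q: "1 \<le> q" and mass: "(\<integral>\<^sup>+ y. ennreal \<bar>K y\<bar> \<partial>lborel) \<le> ennreal c" and c: "0 < c"
    and f: "Lq_le lborel q C (\<lambda>x. ennreal \<bar>f x\<bar>)" and C: "0 \<le> C"
  shows "Lq_le lborel q (c * C) (\<lambda>x. \<integral>\<^sup>+ y. ennreal \<bar>f y * K (x - y)\<bar> \<partial>lborel)"
proof -
  have SF: "sigma_finite_measure (lborel :: 'a measure)" by standard
  have "Lq_le lborel q (c * C) (\<lambda>x. \<integral>\<^sup>+ y. ennreal \<bar>K y\<bar> * ennreal \<bar>f (x - y)\<bar> \<partial>lborel)"
    by (intro Lq_le_nn_integral[OF SF SF q _ _ mass c C] AE_I2 impI Lq_le_shift[of q C "\<lambda>x. ennreal \<bar>f x\<bar>"] f) measurable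
  moreover have "(\<integral>\<^sup>+ y. ennreal \<bar>K y\<bar> * ennreal \<bar>f (x - y)\<bar> \<partial>lborel) = (\<integral>\<^sup>+ y. ennreal \<bar>f y * K (x - y)\<bar> \<partial>lborel)" for x
    using nn_integral_lborel_reflect[of "\<lambda>y. ennreal \<bar>f y * K (x - y)\<bar>" x]
    by (simp add: abs_mult ennreal_mult mult.commute)
  ultimately show ?thesis by simp
qed

text \<open>The singularity \<open>\<sigma>^(\<alpha> - 1)\<close> is integrable at 0, and \<open>exp (- \<rho> \<sigma>)\<close> makes the weighted mass finite, by the
  integral for \<open>Gamma \<alpha>\<close>; as \<open>\<rho>\<close> grows the mass tends to 0 by dominated convergence.\<close>
lemma contractive_kernel_exists:
  fixes k :: "real \<Rightarrow> 'a::euclidean_space \<Rightarrow> real"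
  assumes k[measurable]: "case_prod k \<in> borel_measurable (borel \<Otimes>\<^sub>M borel)" and \<alpha>: "0 < \<alpha>" and m: "m < \<infinity>"
    and mass: "\<And>\<sigma>. 0 < \<sigma> \<Longrightarrow> (\<integral>\<^sup>+ z. ennreal \<bar>k \<sigma> z\<bar> \<partial>lborel) = ennreal (\<sigma> powr (\<alpha> - 1)) * m"
  obtains \<rho> where "contractive_kernel k \<rho>"
proof -
  define g where "g n \<sigma> = indicator {0<..} \<sigma> * (ennreal (exp (- real (Suc n) * \<sigma>)) * (\<integral>\<^sup>+ z. ennreal \<bar>k \<sigma> z\<bar> \<partial>lborel))" for n \<sigma>
  have [measurable]: "g n \<in> borel_measurable borel" for n unfolding g_def by measurable
  have mass_fin: "(\<integral>\<^sup>+ z. ennreal \<bar>k \<sigma> z\<bar> \<partial>lborel) < \<infinity>" if "0 < \<sigma>" for \<sigma>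
    using m that by (simp add: mass ennreal_mult_less_top)
  have "(\<lambda>n. \<integral>\<^sup>+ \<sigma>. g n \<sigma> \<partial>lborel) \<longlonglongrightarrow> (\<integral>\<^sup>+ \<sigma>. 0 \<partial>(lborel :: real measure))"
  proof (rule nn_integral_dominated_convergence[where w = "g 0"])
    show "AE \<sigma> in lborel. g n \<sigma> \<le> g 0 \<sigma>" for n
    proof (intro AE_I2)
      fix \<sigma> :: real
      have "exp (- real (Suc n) * \<sigma>) \<le> exp (- real (Suc 0) * \<sigma>)" if "0 < \<sigma>"
      proof -
        have "- real (Suc n) \<le> - real (Suc 0)" by simp
        then have "- real (Suc n) * \<sigma> \<le> - real (Suc 0) * \<sigma>" using that by (intro mult_right_mono) auto
        then show ?thesis by (simp only: exp_le_cancel_iff)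
      qed
      then show "g n \<sigma> \<le> g 0 \<sigma>"
        unfolding g_def by (auto simp: indicator_def intro!: mult_right_mono ennreal_leI)
    qed
    have "g 0 \<sigma> \<le> ennreal (indicator {0..} \<sigma> * \<sigma> powr (\<alpha> - 1) / exp \<sigma>) * m" for \<sigma>
    proof (cases "0 < \<sigma>")
      case True
      then have "g 0 \<sigma> = ennreal (exp (- \<sigma>)) * ennreal (\<sigma> powr (\<alpha> - 1)) * m"
        by (simp add: g_def mass mult.assoc)
      also have "ennreal (exp (- \<sigma>)) * ennreal (\<sigma> powr (\<alpha> - 1)) = ennreal (\<sigma> powr (\<alpha> - 1) / exp \<sigma>)"
        by (simp add: ennreal_mult[symmetric] exp_minus divide_inverse mult.commute)
      finally show ?thesis using True by simp
    qed (simp add: g_def)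
    then have "(\<integral>\<^sup>+ \<sigma>. g 0 \<sigma> \<partial>lborel) \<le> (\<integral>\<^sup>+ \<sigma>. ennreal (indicator {0..} \<sigma> * \<sigma> powr (\<alpha> - 1) / exp \<sigma>) * m \<partial>lborel)"
      by (intro nn_integral_mono)
    also have "\<dots> = ennreal (Gamma \<alpha>) * m"
      by (subst nn_integral_multc) (auto simp: Gamma_conv_nn_integral_real[OF \<alpha>])
    also have "\<dots> < \<infinity>" using m by (simp add: ennreal_mult_less_top)
    finally show "(\<integral>\<^sup>+ \<sigma>. g 0 \<sigma> \<partial>lborel) < \<infinity>" .
    show "AE \<sigma> in lborel. (\<lambda>n. g n \<sigma>) \<longlonglongrightarrow> 0"
    proof (intro AE_I2)
      fix \<sigma> :: real
      show "(\<lambda>n. g n \<sigma>) \<longlonglongrightarrow> 0"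
      proof (cases "0 < \<sigma>")
        case True
        have "(\<lambda>n. exp (- \<sigma>) ^ Suc n) \<longlonglongrightarrow> 0"
          using True by (intro LIMSEQ_Suc LIMSEQ_realpow_zero) auto
        then have "(\<lambda>n. exp (- real (Suc n) * \<sigma>)) \<longlonglongrightarrow> 0"
          by (simp only: exp_of_nat_mult[symmetric] mult_minus_right mult_minus_left)
        then have "(\<lambda>n. ennreal (exp (- real (Suc n) * \<sigma>))) \<longlonglongrightarrow> ennreal 0" by (rule tendsto_ennrealI)
        then have "(\<lambda>n. (\<integral>\<^sup>+ z. ennreal \<bar>k \<sigma> z\<bar> \<partial>lborel) * ennreal (exp (- real (Suc n) * \<sigma>))) \<longlonglongrightarrow> (\<integral>\<^sup>+ z. ennreal \<bar>k \<sigma> z\<bar> \<partial>lborel) * ennreal 0"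
          by (intro ennreal_tendsto_cmult mass_fin[OF True, unfolded infinity_ennreal_def])
        then show ?thesis using True by (simp add: g_def mult.commute)
      qed (simp add: g_def)
    qed
  qed measurable
  then have "\<forall>\<^sub>F n in sequentially. (\<integral>\<^sup>+ \<sigma>. g n \<sigma> \<partial>lborel) < ennreal (1 / 2)"
    by (intro order_tendstoD(2)[of _ 0]) (auto simp del: ennreal_half)
  then obtain n where "(\<integral>\<^sup>+ \<sigma>. g n \<sigma> \<partial>lborel) < ennreal (1 / 2)"
    by (auto simp: eventually_sequentially)
  then have "contractive_kernel k (real (Suc n))"
    unfolding g_def by unfold_locales (auto intro: less_imp_le)
  then show ?thesis by (rule that)
qed

lemma ereal_less_time: "a < b \<Longrightarrow> ereal b < T \<Longrightarrow> ereal a < T"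
  using less_trans[of "ereal a" "ereal b" T] by simp

text \<open>Solutions and kernels are prescribed for positive times below \<open>T\<close> only. Extension by 0 makes them jointly
  measurable on the whole space and does not change the integrals over \<open>(0, t)\<close> for \<open>t < T\<close>.\<close>
definition cutoff :: "ereal \<Rightarrow> (real \<Rightarrow> 'a \<Rightarrow> real) \<Rightarrow> real \<Rightarrow> 'a \<Rightarrow> real" where
  "cutoff T u t x = (if 0 < t \<and> ereal t < T then u t x else 0)"

lemma measurable_cutoff:
  fixes u :: "real \<Rightarrow> 'a::euclidean_space \<Rightarrow> real"
  assumes "set_borel_measurable lborel ({t. 0 < t \<and> ereal t < T} \<times> UNIV) (\<lambda>(t, x). u t x)"
  shows "case_prod (cutoff T u) \<in> borel_measurable (borel \<Otimes>\<^sub>M borel)"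
proof -
  have "(\<lambda>p. indicator ({t. 0 < t \<and> ereal t < T} \<times> UNIV) p *\<^sub>R (case p of (t, x) \<Rightarrow> u t x)) = case_prod (cutoff T u)"
    by (auto simp: cutoff_def indicator_def)
  then show ?thesis using assms by (simp add: set_borel_measurable_def borel_prod)
qed

text \<open>For \<open>p = 1\<close> the nonlinearity \<open>|u|^(p - 1) u\<close> is \<open>u\<close>, also at \<open>u = 0\<close>, where the power is 0.\<close>
lemma Lq_solution_linear_iff:
  "Lq_solution Z Y 1 q u0 T u \<longleftrightarrow>
     0 < T \<and> Linf_loc_Lq q T u \<and>
     (AE t in lborel. 0 < t \<and> ereal t < T \<longrightarrow>
        (AE x in lborel. integrable lborel (\<lambda>y. u0 y * Z t (x - y)) \<and>
           duhamel_integrable (cutoff \<infinity> Y) (cutoff T u) t x \<and>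
           u t x = (LINT y|lborel. u0 y * Z t (x - y)) + duhamel (cutoff \<infinity> Y) (cutoff T u) t x)) \<and>
     (\<forall>\<epsilon>>0. \<exists>\<delta>>0. AE t in lborel. 0 < t \<and> t < \<delta> \<longrightarrow> Lq_norm q (\<lambda>x. u t x - u0 x) < ennreal \<epsilon>)"
proof -
  have one: "\<bar>a\<bar> powr (1 - 1) * a = a" for a :: real by (cases "a = 0") auto
  have int: "set_integrable lborel ({0<..<t} \<times> UNIV) (\<lambda>(s, y). \<bar>u s y\<bar> powr (1 - 1) * u s y * Y (t - s) (x - y))
      \<longleftrightarrow> duhamel_integrable (cutoff \<infinity> Y) (cutoff T u) t x" if t: "ereal t < T" for t x
    unfolding one using t
    by (intro set_integrable_cong refl) (auto simp: cutoff_def dest: ereal_less_time)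
  have integral: "(LINT s:{0<..<t}|lborel. LINT y|lborel. \<bar>u s y\<bar> powr (1 - 1) * u s y * Y (t - s) (x - y))
      = duhamel (cutoff \<infinity> Y) (cutoff T u) t x"
    if t: "ereal t < T" and "duhamel_integrable (cutoff \<infinity> Y) (cutoff T u) t x" for t x
    unfolding one duhamel_eq_iterated[OF that(2)] using t
    by (intro set_lebesgue_integral_cong) (auto simp: cutoff_def dest: ereal_less_time)
  have "(0 < t \<and> ereal t < T \<longrightarrow> (AE x in lborel. integrable lborel (\<lambda>y. u0 y * Z t (x - y)) \<and>
       set_integrable lborel ({0<..<t} \<times> UNIV) (\<lambda>(s, y). \<bar>u s y\<bar> powr (1 - 1) * u s y * Y (t - s) (x - y)) \<and>
       u t x = (LINT y|lborel. u0 y * Z t (x - y)) +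
         (LINT s:{0<..<t}|lborel. LINT y|lborel. \<bar>u s y\<bar> powr (1 - 1) * u s y * Y (t - s) (x - y))))
    \<longleftrightarrow> (0 < t \<and> ereal t < T \<longrightarrow> (AE x in lborel. integrable lborel (\<lambda>y. u0 y * Z t (x - y)) \<and>
       duhamel_integrable (cutoff \<infinity> Y) (cutoff T u) t x \<and>
       u t x = (LINT y|lborel. u0 y * Z t (x - y)) + duhamel (cutoff \<infinity> Y) (cutoff T u) t x))" for t
    by (intro imp_cong refl arg_cong[where f = "almost_everywhere lborel"] ext conj_cong)
      (use int integral in auto)
  then show ?thesis unfolding Lq_solution_def by (simp only:)
qed

lemma Linf_loc_LqD:
  fixes u :: "real \<Rightarrow> real ^ 'n \<Rightarrow> real"
  assumes u: "Linf_loc_Lq q T u" and q: "1 \<le> q" and T': "0 < T'" "ereal T' < T"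
  obtains C where "0 < C" "AE t in lborel. 0 < t \<and> t < T' \<longrightarrow> Lq_le lborel q C (\<lambda>x. ennreal \<bar>cutoff T u t x\<bar>)"
proof -
  have [measurable]: "case_prod (cutoff T u) \<in> borel_measurable (borel \<Otimes>\<^sub>M borel)"
    using u by (intro measurable_cutoff) (simp add: Linf_loc_Lq_def)
  obtain C where C: "AE t in lborel. 0 < t \<and> t < T' \<longrightarrow> Lq_norm q (u t) \<le> ennreal C"
    using u T' by (auto simp: Linf_loc_Lq_def)
  have "AE t in lborel. 0 < t \<and> t < T' \<longrightarrow> Lq_le lborel q (max 1 C) (\<lambda>x. ennreal \<bar>cutoff T u t x\<bar>)"
    using C
  proof eventually_elim
    case (elim t)
    show ?case
    proof
      assume t: "0 < t \<and> t < T'"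
      then have "ereal t < T" using T' by (auto intro: ereal_less_time)
      then have eq: "cutoff T u t = u t" using t by (auto simp: cutoff_def)
      have [measurable]: "cutoff T u t \<in> borel_measurable borel" by measurable
      have "Lq_norm q (cutoff T u t) \<le> ennreal (max 1 C)"
        using elim t by (auto simp: eq intro: order_trans ennreal_leI)
      then show "Lq_le lborel q (max 1 C) (\<lambda>x. ennreal \<bar>cutoff T u t x\<bar>)"
        by (subst (asm) Lq_norm_le_iff) (auto simp: q)
    qed
  qed
  \<comment> \<open>The bound in the hypothesis may be negative; the triangle inequality needs positive bounds.\<close>
  then show ?thesis by (intro that[of "max 1 C"]) auto
qed

text \<open>The difference of two solutions satisfies the homogeneous equation, so its absolute value is a
  subsolution of the contraction. On every \<open>(0, r)\<close> with \<open>r < S\<close> it is bounded in \<open>L^q\<close> and hence zero; rational \<open>r\<close>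
  exhaust \<open>(0, S)\<close> while keeping the exceptional sets countable in number.\<close>
lemma Lq_solution_unique:
  fixes Y Z u v :: "real \<Rightarrow> real ^ 'n \<Rightarrow> real"
  assumes k: "contractive_kernel (cutoff \<infinity> Y) \<rho>" and q: "1 \<le> q"
    and u: "Lq_solution Z Y 1 q u0 T u" and v: "Lq_solution Z Y 1 q u0 S v" and ST: "S \<le> T"
  shows "AE t in lborel. 0 < t \<and> ereal t < S \<longrightarrow> (AE x in lborel. u t x = v t x)"
proof -
  interpret contractive_kernel "cutoff \<infinity> Y" \<rho> by fact
  have SF: "sigma_finite_measure (lborel :: (real ^ 'n) measure)" by standard
  note u' = u[unfolded Lq_solution_linear_iff] and v' = v[unfolded Lq_solution_linear_iff]
  have um[measurable]: "case_prod (cutoff T u) \<in> borel_measurable (borel \<Otimes>\<^sub>M borel)"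
    using u' by (intro measurable_cutoff) (simp add: Linf_loc_Lq_def)
  have vm[measurable]: "case_prod (cutoff S v) \<in> borel_measurable (borel \<Otimes>\<^sub>M borel)"
    using v' by (intro measurable_cutoff) (simp add: Linf_loc_Lq_def)
  define w where "w t x = cutoff T u t x - cutoff S v t x" for t x
  have wm[measurable]: "case_prod w \<in> borel_measurable (borel \<Otimes>\<^sub>M borel)" unfolding w_def by measurable
  have eq: "AE t in lborel. 0 < t \<and> ereal t < S \<longrightarrow> (AE x in lborel. ennreal \<bar>w t x\<bar> \<le> duhamel_nn (cutoff \<infinity> Y) (\<lambda>s y. ennreal \<bar>w s y\<bar>) t x)"
    using u'[THEN conjunct2, THEN conjunct2, THEN conjunct1] v'[THEN conjunct2, THEN conjunct2, THEN conjunct1]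
  proof eventually_elim
    case (elim t)
    show ?case
    proof
      assume t: "0 < t \<and> ereal t < S"
      then have tT: "0 < t \<and> ereal t < T" using ST by auto
      from mp[OF elim(1) tT] mp[OF elim(2) t]
      show "AE x in lborel. ennreal \<bar>w t x\<bar> \<le> duhamel_nn (cutoff \<infinity> Y) (\<lambda>s y. ennreal \<bar>w s y\<bar>) t x"
      proof eventually_elim
        case (elim x)
        have "w t x = duhamel (cutoff \<infinity> Y) (cutoff T u) t x - duhamel (cutoff \<infinity> Y) (cutoff S v) t x"
          using elim t tT by (auto simp: w_def cutoff_def)
        also have "\<dots> = duhamel (cutoff \<infinity> Y) w t x"
          using elim by (subst duhamel_diff[symmetric]) (auto simp: w_def[abs_def])
        finally show ?case using abs_duhamel_le[OF measurable_k wm, of t x] by simp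
      qed
    qed
  qed
  have local: "AE t in lborel. 0 < t \<and> t < T' \<longrightarrow> (AE x in lborel. ennreal \<bar>w t x\<bar> = 0)" if T': "0 < T'" "ereal T' < S" for T'
  proof -
    obtain C where C: "0 < C" "AE t in lborel. 0 < t \<and> t < T' \<longrightarrow> Lq_le lborel q C (\<lambda>x. ennreal \<bar>cutoff T u t x\<bar>)"
      using u' T' ST by (elim conjE Linf_loc_LqD[OF _ q T'(1)]) auto
    obtain D where D: "0 < D" "AE t in lborel. 0 < t \<and> t < T' \<longrightarrow> Lq_le lborel q D (\<lambda>x. ennreal \<bar>cutoff S v t x\<bar>)"
      using v' T' by (elim conjE Linf_loc_LqD[OF _ q T'(1)]) auto
    show ?thesis
    proof (rule duhamel_subsolution_eq_0[where C = "C + D", OF _ q])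
      show "AE t in lborel. 0 < t \<and> t < T' \<longrightarrow> Lq_le lborel q (C + D) (\<lambda>x. ennreal \<bar>w t x\<bar>)"
        using C(2) D(2)
      proof eventually_elim
        case (elim t)
        show ?case
        proof
          assume "0 < t \<and> t < T'"
          then have "Lq_le lborel q (C + D) (\<lambda>x. ennreal \<bar>cutoff T u t x\<bar> + ennreal \<bar>cutoff S v t x\<bar>)"
            using elim C D by (intro Lq_le_add[OF SF q]) auto
          then show "Lq_le lborel q (C + D) (\<lambda>x. ennreal \<bar>w t x\<bar>)"
            using C D by (elim Lq_le_mono)
              (auto simp: w_def ennreal_plus[symmetric] simp del: ennreal_plus intro!: AE_I2 ennreal_leI)
        qed
      qed
      show "AE t in lborel. 0 < t \<and> t < T' \<longrightarrow> (AE x in lborel. ennreal \<bar>w t x\<bar> \<le> duhamel_nn (cutoff \<infinity> Y) (\<lambda>s y. ennreal \<bar>w s y\<bar>) t x)"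
        using eq
      proof eventually_elim
        case (elim t)
        then show ?case using T' by (auto intro: ereal_less_time)
      qed
    qed (use C D in auto)
  qed
  have "AE t in lborel. \<forall>r::rat. 0 < real_of_rat r \<and> ereal (real_of_rat r) < S \<longrightarrow>
      (0 < t \<and> t < real_of_rat r \<longrightarrow> (AE x in lborel. ennreal \<bar>w t x\<bar> = 0))"
    unfolding AE_all_countable using local by auto
  then show ?thesis
  proof eventually_elim
    case (elim t)
    show ?case
    proof
      assume t: "0 < t \<and> ereal t < S"
      then obtain r :: rat where r: "ereal t < ereal (real_of_rat r)" "ereal (real_of_rat r) < S"
        using ereal_dense3[of "ereal t" S] by auto
      have "t < real_of_rat r" using r by simp
      then have rt: "0 < t \<and> t < real_of_rat r" using t by simp
      then have "0 < real_of_rat r \<and> ereal (real_of_rat r) < S"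
        using less_trans[of 0 t "real_of_rat r"] r(2) by blast
      then have "AE x in lborel. ennreal \<bar>w t x\<bar> = 0" by (rule elim[THEN spec, THEN mp, THEN mp, OF _ rt])
      then show "AE x in lborel. u t x = v t x"
      proof eventually_elim
        case (elim x)
        moreover have "ereal t < T" using t ST by auto
        ultimately show ?case using t by (simp add: w_def cutoff_def ennreal_eq_0_iff)
      qed
    qed
  qed
qed

text \<open>The Neumann series solves the integral equation for all times. Its growth is at most exponential,
  which is the local boundedness in time, and at time 0 the datum is attained because \<open>Z(t) * u0\<close> tends to
  \<open>u0\<close> by assumption and the Duhamel term tends to 0.\<close>
lemma Lq_solution_global_exists:
  fixes Y Z :: "real \<Rightarrow> real ^ 'n \<Rightarrow> real"
  assumes k: "contractive_kernel (cutoff \<infinity> Y) \<rho>" and q: "1 \<le> q"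
    and Zm[measurable]: "case_prod (cutoff \<infinity> Z) \<in> borel_measurable (borel \<Otimes>\<^sub>M borel)"
    and mass: "\<And>t. 0 < t \<Longrightarrow> (\<integral>\<^sup>+ x. ennreal \<bar>Z t x\<bar> \<partial>lborel) \<le> ennreal c" and c: "0 < c"
    and u0: "u0 \<in> Lq_space q"
    and initial: "\<And>\<epsilon>. 0 < \<epsilon> \<Longrightarrow> \<exists>\<delta>>0. AE t in lborel. 0 < t \<and> t < \<delta> \<longrightarrow>
      Lq_le lborel q \<epsilon> (\<lambda>x. ennreal \<bar>(LINT y|lborel. u0 y * Z t (x - y)) - u0 x\<bar>)"
  shows "\<exists>u. Lq_solution Z Y 1 q u0 \<infinity> u"
proof -
  interpret contractive_kernel "cutoff \<infinity> Y" \<rho> by fact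
  have SF: "sigma_finite_measure (lborel :: (real ^ 'n) measure)" by standard
  have u0m[measurable]: "u0 \<in> borel_measurable borel" and "Lq_norm q u0 < \<infinity>"
    using u0 by (auto simp: Lq_space_def)
  then obtain C0 where "0 \<le> C0" "Lq_norm q u0 = ennreal C0" by (cases "Lq_norm q u0") auto
  then have "Lq_le lborel q C0 (\<lambda>x. ennreal \<bar>u0 x\<bar>)"
    using Lq_norm_le_iff[of u0 q C0] q by simp
  then obtain C where C: "0 < C" "Lq_le lborel q C (\<lambda>x. ennreal \<bar>u0 x\<bar>)"
    using \<open>0 \<le> C0\<close> Lq_le_mono[of lborel q C0 "\<lambda>x. ennreal \<bar>u0 x\<bar>" "\<lambda>x. ennreal \<bar>u0 x\<bar>" "C0 + 1"]
      that[of "C0 + 1"] by auto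
  define z where "z t x = (LINT y|lborel. u0 y * cutoff \<infinity> Z t (x - y))" for t x
  have zm[measurable]: "case_prod z \<in> borel_measurable (borel \<Otimes>\<^sub>M borel)" unfolding z_def by measurable
  have Zt: "cutoff \<infinity> Z t = Z t" if "0 < t" for t using that by (auto simp: cutoff_def)
  have Ztm[measurable]: "Z t \<in> borel_measurable borel" if "0 < t" for t
  proof -
    have "cutoff \<infinity> Z t \<in> borel_measurable borel" by measurable
    then show ?thesis using that by (simp add: Zt)
  qed
  have conv: "Lq_le lborel q (c * C) (\<lambda>x. \<integral>\<^sup>+ y. ennreal \<bar>u0 y * Z t (x - y)\<bar> \<partial>lborel)" if t: "0 < t" for t
    by (rule convolution_Lq_le[OF _ _ q mass[OF t] c C(2)]) (use t C in auto)
  have int: "AE x in lborel. integrable lborel (\<lambda>y. u0 y * Z t (x - y))" if t: "0 < t" for t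
  proof -
    note [measurable] = Ztm[OF t]
    have "AE x in lborel. (\<integral>\<^sup>+ y. ennreal \<bar>u0 y * Z t (x - y)\<bar> \<partial>lborel) < \<infinity>"
      by (rule Lq_le_imp_finite[OF conv[OF t]]) measurable
    then show ?thesis by eventually_elim (auto simp: integrable_iff_bounded)
  qed
  have z_bound: "Lq_le lborel q (exp (\<rho> * t) * (c * C)) (\<lambda>x. ennreal \<bar>z t x\<bar>)" if t: "0 < t" for t
  proof (rule Lq_le_mono[OF conv[OF t]])
    show "AE x in lborel. ennreal \<bar>z t x\<bar> \<le> (\<integral>\<^sup>+ y. ennreal \<bar>u0 y * Z t (x - y)\<bar> \<partial>lborel)"
      using int[OF t]
    proof eventually_elim
      case (elim x)
      then show ?case
        using integral_norm_bound_ennreal[OF elim] by (simp add: z_def Zt[OF t])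
    qed
    have "1 * (c * C) \<le> exp (\<rho> * t) * (c * C)"
      using rate_nonneg t c C by (intro mult_right_mono) auto
    then show "c * C \<le> exp (\<rho> * t) * (c * C)" by simp
  qed (use c C in auto)
  define M where "M = c * C"
  have M: "0 < M" using c C by (simp add: M_def)
  obtain u where um[measurable]: "case_prod u \<in> borel_measurable (borel \<Otimes>\<^sub>M borel)"
    and u_bound: "\<And>t. 0 < t \<Longrightarrow> Lq_le lborel q (exp (\<rho> * t) * (2 * M)) (\<lambda>x. ennreal \<bar>u t x\<bar>)"
    and u_eq: "\<And>t. 0 < t \<Longrightarrow> AE x in lborel. duhamel_integrable (cutoff \<infinity> Y) u t x \<and> u t x = z t x + duhamel (cutoff \<infinity> Y) u t x"
    using duhamel_solution_exists[OF zm q M z_bound[folded M_def]] by blast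
  have utm[measurable]: "u t \<in> borel_measurable borel" for t by measurable
  have cut: "duhamel_integrable (cutoff \<infinity> Y) (cutoff \<infinity> u) t x \<longleftrightarrow> duhamel_integrable (cutoff \<infinity> Y) u t x"
    "duhamel (cutoff \<infinity> Y) (cutoff \<infinity> u) t x = duhamel (cutoff \<infinity> Y) u t x" for t x
    unfolding duhamel_def
    by (intro set_integrable_cong set_lebesgue_integral_cong refl; force simp: cutoff_def borel_prod[symmetric])+
  have "Lq_solution Z Y 1 q u0 \<infinity> u"
    unfolding Lq_solution_linear_iff Linf_loc_Lq_def
  proof (intro conjI allI impI)
    have "{t. 0 < t \<and> ereal t < \<infinity>} = {0<..}" by auto
    moreover have "(\<lambda>p. indicator ({0<..} \<times> UNIV) p *\<^sub>R (case p of (t, x) \<Rightarrow> u t x)) \<in> borel_measurable (borel \<Otimes>\<^sub>M borel)"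
      by measurable
    ultimately show "set_borel_measurable lborel ({t. 0 < t \<and> ereal t < \<infinity>} \<times> UNIV) (\<lambda>(t, x). u t x)"
      by (simp add: set_borel_measurable_def borel_prod)
  next
    fix T' assume "0 < T' \<and> ereal T' < \<infinity>"
    have "Lq_norm q (u t) \<le> ennreal (exp (\<rho> * T') * (2 * M))" if t: "0 < t" "t < T'" for t
    proof (subst Lq_norm_le_iff)
      have "exp (\<rho> * t) * (2 * M) \<le> exp (\<rho> * T') * (2 * M)"
        using t rate_nonneg M by (intro mult_right_mono) (auto intro: mult_left_mono)
      then show "Lq_le lborel q (exp (\<rho> * T') * (2 * M)) (\<lambda>x. ennreal \<bar>u t x\<bar>)"
        by (intro Lq_le_mono[OF u_bound[OF t(1)]]) (use M in auto)
    qed (use q M in auto)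
    then show "\<exists>C. AE t in lborel. 0 < t \<and> t < T' \<longrightarrow> Lq_norm q (u t) \<le> ennreal C" by auto
  next
    show "AE t in lborel. 0 < t \<and> ereal t < \<infinity> \<longrightarrow> (AE x in lborel.
      integrable lborel (\<lambda>y. u0 y * Z t (x - y)) \<and> duhamel_integrable (cutoff \<infinity> Y) (cutoff \<infinity> u) t x \<and>
      u t x = (LINT y|lborel. u0 y * Z t (x - y)) + duhamel (cutoff \<infinity> Y) (cutoff \<infinity> u) t x)"
    proof (rule AE_I2, rule impI)
      fix t assume t: "0 < t \<and> ereal t < \<infinity>"
      then have "0 < t" ..
      from int[OF this] u_eq[OF this]
      show "AE x in lborel.
        integrable lborel (\<lambda>y. u0 y * Z t (x - y)) \<and> duhamel_integrable (cutoff \<infinity> Y) (cutoff \<infinity> u) t x \<and>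
        u t x = (LINT y|lborel. u0 y * Z t (x - y)) + duhamel (cutoff \<infinity> Y) (cutoff \<infinity> u) t x"
        by eventually_elim (use t in \<open>simp add: cut z_def Zt\<close>)
    qed
  next
    fix \<epsilon> :: real assume \<epsilon>: "0 < \<epsilon>"
    define e where "e = \<epsilon> / 4"
    have e: "0 < e" "e + e < \<epsilon>" using \<epsilon> by (auto simp: e_def)
    define B where "B = exp \<rho> * (2 * M)"
    obtain \<delta>1 where \<delta>1: "0 < \<delta>1" and init: "AE t in lborel. 0 < t \<and> t < \<delta>1 \<longrightarrow>
      Lq_le lborel q e (\<lambda>x. ennreal \<bar>(LINT y|lborel. u0 y * Z t (x - y)) - u0 x\<bar>)"
      using initial[OF e(1)] by auto
    obtain \<delta>2 where \<delta>2: "0 < \<delta>2" and small: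
      "\<And>W t. case_prod W \<in> borel_measurable (borel \<Otimes>\<^sub>M borel) \<Longrightarrow> 0 < t \<Longrightarrow> t < \<delta>2 \<Longrightarrow>
       (AE s in lborel. 0 < s \<and> s < t \<longrightarrow> Lq_le lborel q B (W s)) \<Longrightarrow> Lq_le lborel q e (duhamel_nn (cutoff \<infinity> Y) W t)"
      using duhamel_nn_small_time[OF q _ e(1), of B] M by (auto simp: B_def)
    \<comment> \<open>Times below 1 make the exponential growth factor of \<open>u\<close> at most \<open>exp \<rho>\<close>.\<close>
    have "AE t in lborel. 0 < t \<and> t < min 1 (min \<delta>1 \<delta>2) \<longrightarrow> Lq_norm q (\<lambda>x. u t x - u0 x) < ennreal \<epsilon>"
      using init
    proof eventually_elim
      case (elim t)
      show ?case
      proof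
        assume t: "0 < t \<and> t < min 1 (min \<delta>1 \<delta>2)"
        then have t0: "0 < t" by simp
        note [measurable] = Ztm[OF t0]
        have "AE s in lborel. 0 < s \<and> s < t \<longrightarrow> Lq_le lborel q B (\<lambda>x. ennreal \<bar>u s x\<bar>)"
        proof (intro AE_I2 impI)
          fix s assume s: "0 < s \<and> s < t"
          have "\<rho> * s \<le> \<rho> * 1" using s t rate_nonneg by (intro mult_left_mono) auto
          then have "exp (\<rho> * s) * (2 * M) \<le> B" unfolding B_def using M by (intro mult_right_mono) auto
          then show "Lq_le lborel q B (\<lambda>x. ennreal \<bar>u s x\<bar>)"
            by (intro Lq_le_mono[OF u_bound]) (use M s in auto)
        qed
        then have D: "Lq_le lborel q e (duhamel_nn (cutoff \<infinity> Y) (\<lambda>s y. ennreal \<bar>u s y\<bar>) t)"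
          using t by (intro small) auto
        have Dm: "duhamel_nn (cutoff \<infinity> Y) (\<lambda>s y. ennreal \<bar>u s y\<bar>) t \<in> borel_measurable lborel" by measurable
        have sum: "Lq_le lborel q (e + e) (\<lambda>x. ennreal \<bar>(LINT y|lborel. u0 y * Z t (x - y)) - u0 x\<bar>
            + duhamel_nn (cutoff \<infinity> Y) (\<lambda>s y. ennreal \<bar>u s y\<bar>) t x)"
          using elim t D e by (intro Lq_le_add[OF SF q _ Dm]) auto
        have "Lq_le lborel q (e + e) (\<lambda>x. ennreal \<bar>u t x - u0 x\<bar>)"
        proof (rule Lq_le_mono[OF sum])
          show "AE x in lborel. ennreal \<bar>u t x - u0 x\<bar> \<le> ennreal \<bar>(LINT y|lborel. u0 y * Z t (x - y)) - u0 x\<bar>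
            + duhamel_nn (cutoff \<infinity> Y) (\<lambda>s y. ennreal \<bar>u s y\<bar>) t x"
            using u_eq[OF t0]
          proof eventually_elim
            case (elim x)
            have "ennreal \<bar>u t x - u0 x\<bar> \<le> ennreal (\<bar>z t x - u0 x\<bar> + \<bar>duhamel (cutoff \<infinity> Y) u t x\<bar>)"
              using elim by (intro ennreal_leI) linarith
            also have "\<dots> = ennreal \<bar>z t x - u0 x\<bar> + ennreal \<bar>duhamel (cutoff \<infinity> Y) u t x\<bar>" by simp
            also have "\<dots> \<le> ennreal \<bar>z t x - u0 x\<bar> + duhamel_nn (cutoff \<infinity> Y) (\<lambda>s y. ennreal \<bar>u s y\<bar>) t x"
              by (intro add_left_mono abs_duhamel_le measurable_k um)
            finally show ?case by (simp add: z_def Zt[OF t0])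
          qed
        qed (use e in auto)
        then have "Lq_norm q (\<lambda>x. u t x - u0 x) \<le> ennreal (e + e)"
          by (subst Lq_norm_le_iff) (use q e in auto)
        also have "\<dots> < ennreal \<epsilon>" using e by (intro ennreal_lessI) auto
        finally show "Lq_norm q (\<lambda>x. u t x - u0 x) < ennreal \<epsilon>" .
      qed
    qed
    then show "\<exists>\<delta>>0. AE t in lborel. 0 < t \<and> t < \<delta> \<longrightarrow> Lq_norm q (\<lambda>x. u t x - u0 x) < ennreal \<epsilon>"
      using \<delta>1 \<delta>2 by (intro exI[of _ "min 1 (min \<delta>1 \<delta>2)"]) auto
  qed simp
  then show ?thesis by blast
qed

text \<open>From any local solution \<open>v\<close>: \<open>Z(t) * u0 - u0\<close> is the difference of \<open>v(t) - u0\<close> and the Duhamel term of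
  \<open>v\<close>, and both tend to 0. This covers \<open>q = \<infinity>\<close>, where for general data the convolutions do not converge
  in norm.\<close>
lemma initial_datum_attained_of_solution:
  fixes Y Z :: "real \<Rightarrow> real ^ 'n \<Rightarrow> real"
  assumes k: "contractive_kernel (cutoff \<infinity> Y) \<rho>" and q: "1 \<le> q"
    and u0: "u0 \<in> Lq_space q" and v: "Lq_solution Z Y 1 q u0 T v" and \<epsilon>: "0 < \<epsilon>"
  shows "\<exists>\<delta>>0. AE t in lborel. 0 < t \<and> t < \<delta> \<longrightarrow>
      Lq_le lborel q \<epsilon> (\<lambda>x. ennreal \<bar>(LINT y|lborel. u0 y * Z t (x - y)) - u0 x\<bar>)"
proof -
  interpret contractive_kernel "cutoff \<infinity> Y" \<rho> by fact
  have SF: "sigma_finite_measure (lborel :: (real ^ 'n) measure)" by standard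
  have u0m[measurable]: "u0 \<in> borel_measurable borel"
    using u0 by (auto simp: Lq_space_def)
  note v' = v[unfolded Lq_solution_linear_iff]
  have vm[measurable]: "case_prod (cutoff T v) \<in> borel_measurable (borel \<Otimes>\<^sub>M borel)"
    using v' by (intro measurable_cutoff) (simp add: Linf_loc_Lq_def)
  have vtm[measurable]: "cutoff T v t \<in> borel_measurable borel" for t by measurable
  define e where "e = \<epsilon> / 2"
  have e: "0 < e" "e + e \<le> \<epsilon>" using \<epsilon> by (auto simp: e_def)
  obtain T' where T': "0 < T'" "ereal T' < T"
    using v' ereal_dense2[of 0 T] by auto
  obtain B where B: "0 < B" "AE t in lborel. 0 < t \<and> t < T' \<longrightarrow> Lq_le lborel q B (\<lambda>x. ennreal \<bar>cutoff T v t x\<bar>)"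
    using v' T' by (elim conjE Linf_loc_LqD[OF _ q T'(1)]) auto
  obtain \<delta>1 where \<delta>1: "0 < \<delta>1" and init: "AE t in lborel. 0 < t \<and> t < \<delta>1 \<longrightarrow> Lq_norm q (\<lambda>x. v t x - u0 x) < ennreal e"
    using v' e by blast
  obtain \<delta>2 where \<delta>2: "0 < \<delta>2" and small:
    "\<And>W t. case_prod W \<in> borel_measurable (borel \<Otimes>\<^sub>M borel) \<Longrightarrow> 0 < t \<Longrightarrow> t < \<delta>2 \<Longrightarrow>
     (AE s in lborel. 0 < s \<and> s < t \<longrightarrow> Lq_le lborel q B (W s)) \<Longrightarrow> Lq_le lborel q e (duhamel_nn (cutoff \<infinity> Y) W t)"
    using duhamel_nn_small_time[OF q _ e(1), of B] B by auto
  have "AE t in lborel. 0 < t \<and> t < min T' (min \<delta>1 \<delta>2) \<longrightarrow>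
      Lq_le lborel q \<epsilon> (\<lambda>x. ennreal \<bar>(LINT y|lborel. u0 y * Z t (x - y)) - u0 x\<bar>)"
    using init v'[THEN conjunct2, THEN conjunct2, THEN conjunct1]
  proof eventually_elim
    case (elim t)
    show ?case
    proof
      assume t: "0 < t \<and> t < min T' (min \<delta>1 \<delta>2)"
      then have tT: "0 < t \<and> ereal t < T" using T' by (auto intro: ereal_less_time)
      have vt: "cutoff T v t = v t" using tT by (auto simp: cutoff_def)
      have [measurable]: "v t \<in> borel_measurable borel" using vtm[of t] by (simp add: vt)
      have "AE s in lborel. 0 < s \<and> s < t \<longrightarrow> Lq_le lborel q B (\<lambda>x. ennreal \<bar>cutoff T v s x\<bar>)"
        using B(2) by eventually_elim (use t in auto)
      then have D: "Lq_le lborel q e (duhamel_nn (cutoff \<infinity> Y) (\<lambda>s y. ennreal \<bar>cutoff T v s y\<bar>) t)"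
        using t by (intro small) auto
      have Dm: "duhamel_nn (cutoff \<infinity> Y) (\<lambda>s y. ennreal \<bar>cutoff T v s y\<bar>) t \<in> borel_measurable lborel" by measurable
      have "Lq_norm q (\<lambda>x. v t x - u0 x) \<le> ennreal e" using elim(1) t by auto
      then have "Lq_le lborel q e (\<lambda>x. ennreal \<bar>v t x - u0 x\<bar>)"
        by (subst (asm) Lq_norm_le_iff) (use q e in auto)
      then have sum: "Lq_le lborel q (e + e) (\<lambda>x. ennreal \<bar>v t x - u0 x\<bar> + duhamel_nn (cutoff \<infinity> Y) (\<lambda>s y. ennreal \<bar>cutoff T v s y\<bar>) t x)"
        using D e by (intro Lq_le_add[OF SF q _ Dm]) auto
      show "Lq_le lborel q \<epsilon> (\<lambda>x. ennreal \<bar>(LINT y|lborel. u0 y * Z t (x - y)) - u0 x\<bar>)"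
      proof (rule Lq_le_mono[OF sum])
        show "AE x in lborel. ennreal \<bar>(LINT y|lborel. u0 y * Z t (x - y)) - u0 x\<bar>
          \<le> ennreal \<bar>v t x - u0 x\<bar> + duhamel_nn (cutoff \<infinity> Y) (\<lambda>s y. ennreal \<bar>cutoff T v s y\<bar>) t x"
          using mp[OF elim(2) tT]
        proof eventually_elim
          case (elim x)
          have "ennreal \<bar>(LINT y|lborel. u0 y * Z t (x - y)) - u0 x\<bar>
            \<le> ennreal (\<bar>v t x - u0 x\<bar> + \<bar>duhamel (cutoff \<infinity> Y) (cutoff T v) t x\<bar>)"
            using elim by (intro ennreal_leI) linarith
          also have "\<dots> = ennreal \<bar>v t x - u0 x\<bar> + ennreal \<bar>duhamel (cutoff \<infinity> Y) (cutoff T v) t x\<bar>" by simp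
          also have "\<dots> \<le> ennreal \<bar>v t x - u0 x\<bar> + duhamel_nn (cutoff \<infinity> Y) (\<lambda>s y. ennreal \<bar>cutoff T v s y\<bar>) t x"
            by (intro add_left_mono abs_duhamel_le measurable_k vm)
          finally show ?case .
        qed
      qed (use e in auto)
    qed
  qed
  then show ?thesis using \<delta>1 \<delta>2 T' by (intro exI[of _ "min T' (min \<delta>1 \<delta>2)"]) auto
qed

text \<open>By self-similarity \<open>Z(t) * u0\<close> is the convolution of \<open>u0\<close> with the dilation of \<open>Z 1\<close> by \<open>t^a\<close>, an approximate
  identity.\<close>
lemma initial_datum_attained_finite_exponent:
  fixes Z :: "real \<Rightarrow> real ^ 'n \<Rightarrow> real"
  assumes q: "1 \<le> q" "q \<noteq> \<infinity>" and u0: "u0 \<in> Lq_space q"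
    and Z: "\<And>t. 0 < t \<Longrightarrow> integrable lborel (Z t)" and Z1: "(\<integral> x. Z 1 x \<partial>lborel) = 1"
    and a: "0 < a"
    and scale: "\<And>t. 0 < t \<Longrightarrow> AE x in lborel. Z t x = 1 / (t powr a) ^ CARD('n) * Z 1 ((1 / t powr a) *\<^sub>R x)"
    and \<epsilon>: "0 < \<epsilon>"
  shows "\<exists>\<delta>>0. AE t in lborel. 0 < t \<and> t < \<delta> \<longrightarrow>
      Lq_le lborel q \<epsilon> (\<lambda>x. ennreal \<bar>(LINT y|lborel. u0 y * Z t (x - y)) - u0 x\<bar>)"
proof -
  have u0m[measurable]: "u0 \<in> borel_measurable borel" using u0 by (auto simp: Lq_space_def)
  define r where "r = enn2real q"
  have r: "1 \<le> r" using q enn2real_ge_1 by (auto simp: r_def)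
  have fin: "(\<integral>\<^sup>+ x. ennreal (\<bar>u0 x\<bar> powr r) \<partial>lborel) < \<infinity>"
    using u0 q by (auto simp: Lq_space_def Lq_norm_def r_def Let_def less_top split: if_splits)
  define F where "F s = (\<integral>\<^sup>+ x. epow r (\<integral>\<^sup>+ z. ennreal \<bar>Z 1 z\<bar> * ennreal \<bar>u0 (x - s *\<^sub>R z) - u0 x\<bar> \<partial>lborel) \<partial>lborel)" for s
  have "(F \<longlongrightarrow> 0) (at_right 0)"
    unfolding tendsto_at_iff_sequentially
  proof (intro allI impI)
    fix X :: "nat \<Rightarrow> real" assume "X \<longlonglongrightarrow> 0"
    then show "(F \<circ> X) \<longlonglongrightarrow> 0"
      unfolding F_def comp_def by (intro approximate_identity fin r Z) auto
  qed
  then have "\<forall>\<^sub>F s in at_right 0. F s < ennreal (\<epsilon> powr r)"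
    using \<epsilon> by (intro order_tendstoD) auto
  then obtain d where d: "0 < d" "\<And>s. 0 < s \<Longrightarrow> s < d \<Longrightarrow> F s < ennreal (\<epsilon> powr r)"
    by (auto simp: eventually_at_right_field)
  have "Lq_le lborel q \<epsilon> (\<lambda>x. ennreal \<bar>(LINT y|lborel. u0 y * Z t (x - y)) - u0 x\<bar>)" if t: "0 < t" "t < d powr (1 / a)" for t
  proof -
    have "t powr a < (d powr (1 / a)) powr a" using t a by (intro powr_less_mono2) auto
    then have s: "0 < t powr a" "t powr a < d" using a d t by (auto simp: powr_powr)
    have "(LINT y|lborel. u0 y * Z t (x - y)) = (LINT z|lborel. Z 1 z * u0 (x - t powr a *\<^sub>R z))" for x
      by (rule integral_self_similar[OF _ _ _ s(1) scale[OF t(1)]])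
        (use Z[OF t(1)] Z[of 1] in auto)
    then have "(\<integral>\<^sup>+ x. epow r (ennreal \<bar>(LINT y|lborel. u0 y * Z t (x - y)) - u0 x\<bar>) \<partial>lborel) \<le> F (t powr a)"
      unfolding F_def using r
      by (intro nn_integral_mono epow_mono) (auto intro!: mollification_error_le Z Z1)
    also have "\<dots> \<le> ennreal (\<epsilon> powr r)" using d(2)[OF s] by simp
    finally show ?thesis using q by (simp add: Lq_le_def r_def)
  qed
  then show ?thesis using d by (intro exI[of _ "d powr (1 / a)"]) auto
qed

lemma norm_powr_scaleR:
  fixes \<xi> :: "'a::real_normed_vector"
  assumes "0 < t" "0 < \<beta>"
  shows "norm ((t powr (\<alpha> / (2 * \<beta>))) *\<^sub>R \<xi>) powr (2 * \<beta>) = norm \<xi> powr (2 * \<beta>) * t powr \<alpha>"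
  using assms by (simp add: powr_mult powr_powr)

theorem corollary3p1:
  fixes \<alpha> \<beta> :: real
    and Z Y :: "real \<Rightarrow> real ^ 'n \<Rightarrow> real"
    and q :: ennreal
    and u0 :: "real ^ 'n \<Rightarrow> real"
  assumes "0 < \<alpha>" "\<alpha> < 1"
    and "0 < \<beta>" "\<beta> \<le> 1"
    and "real CARD('n) > 4 * \<beta>"
    and "fundamental_solution \<alpha> \<beta> Z"
    and "duhamel_kernel \<alpha> \<beta> Z Y"
    and "1 \<le> q"
    and "u0 \<in> Lq_space q"
    and "q = \<infinity> \<Longrightarrow> \<exists>T u. Lq_solution Z Y 1 q u0 T u"
  shows "(\<exists>u. maximal_Lq_solution Z Y 1 q u0 u \<and>
            (\<forall>v. maximal_Lq_solution Z Y 1 q u0 v \<longrightarrow>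
               (AE t in lborel. 0 < t \<and> ereal t < maximal_existence_time Z Y 1 q u0 \<longrightarrow>
                  (AE x in lborel. v t x = u t x))))
       \<and> maximal_existence_time Z Y 1 q u0 = \<infinity>"
proof -
  have Zk: "regular_kernel Z" and Zf: "\<And>\<xi> t. 0 < t \<Longrightarrow> fourier (Z t) \<xi> =
        complex_of_real (mittag_leffler \<alpha> 1 (- (norm \<xi> powr (2 * \<beta>)) * t powr \<alpha>))"
    using assms(6) by (auto simp: fundamental_solution_def)
  have Yk: "regular_kernel Y" and Yf: "\<And>\<xi> t. 0 < t \<Longrightarrow> fourier (Y t) \<xi> =
        complex_of_real (t powr (\<alpha> - 1) * mittag_leffler \<alpha> \<alpha> (- (norm \<xi> powr (2 * \<beta>)) * t powr \<alpha>))"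
    using assms(7) by (auto simp: duhamel_kernel_def)
  have Zm: "case_prod (cutoff \<infinity> Z) \<in> borel_measurable (borel \<Otimes>\<^sub>M borel)"
    and Ym: "case_prod (cutoff \<infinity> Y) \<in> borel_measurable (borel \<Otimes>\<^sub>M borel)"
    using Zk Yk by (auto intro!: measurable_cutoff simp: regular_kernel_def greaterThan_def)
  have Zi: "integrable lborel (Z t)" and Yi: "integrable lborel (Y t)" if "0 < t" for t
    using Zk Yk that by (auto simp: regular_kernel_def)
  define a where "a = \<alpha> / (2 * \<beta>)"
  have a: "0 < a" using assms(1,3) by (simp add: a_def)
  have scaleZ: "AE x in lborel. Z t x = 1 / (t powr a) ^ CARD('n) * Z 1 ((1 / t powr a) *\<^sub>R x)" if t: "0 < t" for t
    by (rule self_similar_kernel[OF Zi[OF t] Zi])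
      (use t assms(3) in \<open>auto simp: Zf a_def norm_powr_scaleR simp del: norm_scaleR\<close>)
  have scaleY: "AE x in lborel. Y t x = t powr (\<alpha> - 1) / (t powr a) ^ CARD('n) * Y 1 ((1 / t powr a) *\<^sub>R x)" if t: "0 < t" for t
    by (rule self_similar_kernel[OF Yi[OF t] Yi])
      (use t assms(3) in \<open>auto simp: Yf a_def norm_powr_scaleR simp del: norm_scaleR\<close>)
  have m1: "Z 1 \<in> borel_measurable borel" "Y 1 \<in> borel_measurable borel"
    using borel_measurable_integrable[OF Zi[of 1]] borel_measurable_integrable[OF Yi[of 1]] by simp_all
  have massZ: "(\<integral>\<^sup>+ x. ennreal \<bar>Z t x\<bar> \<partial>lborel) = ennreal 1 * (\<integral>\<^sup>+ x. ennreal \<bar>Z 1 x\<bar> \<partial>lborel)" if t: "0 < t" for t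
    by (rule nn_integral_self_similar[of "Z 1" "t powr a" 1 "Z t", OF m1(1) _ _ scaleZ[OF t]]) (use t in simp_all)
  have massY: "(\<integral>\<^sup>+ x. ennreal \<bar>Y t x\<bar> \<partial>lborel) = ennreal (t powr (\<alpha> - 1)) * (\<integral>\<^sup>+ x. ennreal \<bar>Y 1 x\<bar> \<partial>lborel)" if t: "0 < t" for t
    by (rule nn_integral_self_similar[of "Y 1" "t powr a" "t powr (\<alpha> - 1)" "Y t", OF m1(2) _ _ scaleY[OF t]]) (use t in simp_all)
  have massY': "(\<integral>\<^sup>+ x. ennreal \<bar>cutoff \<infinity> Y t x\<bar> \<partial>lborel)
      = ennreal (t powr (\<alpha> - 1)) * (\<integral>\<^sup>+ x. ennreal \<bar>Y 1 x\<bar> \<partial>lborel)" if t: "0 < t" for t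
    unfolding massY[OF t, symmetric] using t by (simp add: cutoff_def)
  have "(\<integral>\<^sup>+ z. ennreal \<bar>Y 1 z\<bar> \<partial>lborel) < \<infinity>" using Yi[of 1] by (simp add: integrable_iff_bounded)
  then obtain \<rho> where k: "contractive_kernel (cutoff \<infinity> Y) \<rho>"
    by (rule contractive_kernel_exists[OF Ym assms(1) _ massY'])
  define c where "c = (\<integral> x. \<bar>Z 1 x\<bar> \<partial>lborel) + 1"
  have c: "0 < c" by (simp add: c_def add_nonneg_pos)
  have Zc: "(\<integral>\<^sup>+ x. ennreal \<bar>Z t x\<bar> \<partial>lborel) \<le> ennreal c" if t: "0 < t" for t
    unfolding massZ[OF t] using Zi[of 1] by (simp add: nn_integral_eq_integral c_def ennreal_leI)
  \<comment> \<open>Conservation of mass: the transform of \<open>Z\<close> at \<open>\<xi> = 0\<close> is 1.\<close>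
  have "mittag_leffler \<alpha> 1 0 = 1"
    unfolding mittag_leffler_def by (subst suminf_finite[of "{0}"]) auto
  then have "fourier (Z 1) 0 = 1" by (simp add: Zf)
  then have "complex_of_real (\<integral> x. Z 1 x \<partial>lborel) = 1" by (simp add: fourier_def)
  then have Z1: "(\<integral> x. Z 1 x \<partial>lborel) = 1" by simp
  have "\<exists>\<delta>>0. AE t in lborel. 0 < t \<and> t < \<delta> \<longrightarrow>
      Lq_le lborel q \<epsilon> (\<lambda>x. ennreal \<bar>(LINT y|lborel. u0 y * Z t (x - y)) - u0 x\<bar>)" if \<epsilon>: "0 < \<epsilon>" for \<epsilon>
  \<comment> \<open>For \<open>q = \<infinity>\<close> attainment of the datum is drawn from the solution that is assumed to exist.\<close>
  proof (cases "q = \<infinity>")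
    case True
    then obtain T v where "Lq_solution Z Y 1 q u0 T v" using assms(10) by auto
    then show ?thesis by (rule initial_datum_attained_of_solution[OF k assms(8,9) _ \<epsilon>])
  next
    case False
    show ?thesis
      by (rule initial_datum_attained_finite_exponent[OF assms(8) False assms(9) Zi Z1 a scaleZ \<epsilon>])
  qed
  then obtain u where u: "Lq_solution Z Y 1 q u0 \<infinity> u"
    using Lq_solution_global_exists[OF k assms(8) Zm Zc c assms(9)] by blast
  have T_max: "maximal_existence_time Z Y 1 q u0 = \<infinity>"
  proof -
    have "\<infinity> \<le> maximal_existence_time Z Y 1 q u0"
      unfolding maximal_existence_time_def by (rule Sup_upper) (use u in blast)
    then show ?thesis by simp
  qed
  have uniq: "AE t in lborel. 0 < t \<and> ereal t < T \<longrightarrow> (AE x in lborel. u t x = v t x)"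
    if "Lq_solution Z Y 1 q u0 T v" for T v
    by (rule Lq_solution_unique[OF k assms(8) u that]) simp
  have "maximal_Lq_solution Z Y 1 q u0 u"
    unfolding maximal_Lq_solution_def T_max using u uniq by blast
  moreover have "AE t in lborel. 0 < t \<and> ereal t < maximal_existence_time Z Y 1 q u0 \<longrightarrow> (AE x in lborel. v t x = u t x)"
    if "maximal_Lq_solution Z Y 1 q u0 v" for v
    using that u unfolding maximal_Lq_solution_def T_max by blast
  ultimately show ?thesis using T_max by blast
qed

end
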